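(* Let $n\geq 1$, let $\gamma=\gamma_n$ be the standard Gaussian measure on $\mathbb{R}^n$, let $L>0$, and let $f:\mathbb{R}^n\to\mathbb{R}$ be $L$-Lipschitz with respect to the Euclidean distance. Let $M=\mathbb{E}f=\int_{\mathbb{R}^n} f\,d\gamma$ and let $t>0$. Then $$\gamma(\{|f-M|\geq t\})\ \leq\ e^{-t^2/(2L^2)}.$$
   Context: The standard Gaussian measure $\gamma_n$ on $\mathbb{R}^n$ has density $(2\pi)^{-n/2}e^{-|x|^2/2}$ with respect to Lebesgue measure. *)

theory Defs
  imports "HOL-Probability.Probability"
begin

definition std_gaussian :: "(real ^ 'n) measure" where
  "std_gaussian = density lborel
     (\<lambda>x. ennreal ((2 * pi) powr (- real CARD('n) / 2) * exp (- (norm x)\<^sup>2 / 2)))"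

end

theory Submission
  imports Defs "HOL-Real_Asymp.Real_Asymp"
begin

text \<open>
  Rescaling, take \<open>L = 1\<close>. Among the 1-Lipschitz functions \<open>F\<close> with the same law as \<open>f\<close> under the
  Gaussian measure and the unit vectors \<open>v\<close>, a compactness argument gives a pair maximising
  \<open>E (F z * (z \<bullet> v))\<close>. Monotone (Ehrhard) rearrangement of \<open>F\<close> on all lines parallel to a unit vector
  \<open>w\<close> keeps \<open>F\<close> 1-Lipschitz, by the one-dimensional Gaussian isoperimetric inequality, keeps its law and
  the moments in directions orthogonal to \<open>w\<close>, and makes the moment in direction \<open>w\<close> positive unless
  \<open>F\<close> is constant on these lines. Hence the maximiser depends on \<open>z \<bullet> v\<close> only, and \<open>f\<close> has the law
  of \<open>T g\<close> with \<open>T\<close> nondecreasing and 1-Lipschitz and \<open>g\<close> a standard normal variable.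

  For such \<open>T\<close> with mean \<open>0\<close>, let \<open>T \<le> - t\<close> hold exactly on \<open>{..a}\<close>. Then \<open>T x \<le> max (x - a) 0 - t\<close>
  forces \<open>t \<le> E (max (g - a) 0)\<close>, while \<open>T x \<ge> t\<close> needs \<open>x \<ge> a + 2 * t\<close>. So the bound reduces to an
  inequality between \<open>a\<close> and \<open>t\<close>; it is here that the constant \<open>1\<close> instead of \<open>2\<close> is obtained.
\<close>

subsection \<open>One-dimensional tail estimates\<close>

text \<open>Adding the one-sided bounds \<open>exp (- t\<^sup>2 / 2)\<close> would cost a factor 2,
  so both tails must be treated together; for this the law of \<open>f\<close> is realised by one
  monotone function on the line. Maximising a moment takes the place of an isoperimetric inequality
  in \<open>n\<close> dimensions. The direction \<open>v\<close> is varied along with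
  \<open>F\<close> because rearranging along \<open>w\<close> orthogonal to \<open>v\<close> leaves
  the moment \<open>S\<close> along \<open>v\<close> alone and creates a moment
  \<open>\<delta>\<close> along \<open>w\<close>. Tilting \<open>v\<close> towards \<open>w\<close>
  then gives \<open>sqrt (S\<^sup>2 + \<delta>\<^sup>2)\<close>, which exceeds \<open>S\<close>
  unless \<open>\<delta> = 0\<close>. For the maximum to be attained, the competitors must be closed
  under pointwise limits. Hence equality of laws is expressed by integrals of continuous functions
  of linear growth, and level sets are recovered only at the end. On the line, the mean bounds
  \<open>t\<close> by \<open>psi a\<close>, and the Lipschitz condition keeps the two level sets
  \<open>2 * t\<close> apart. If the lower one ends at or below \<open>- t\<close> and the upper one
  begins at or above \<open>t\<close>, each tail is at most half of the bound; the work lies in the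
  remaining case.\<close>

abbreviation \<phi> :: "real \<Rightarrow> real" where "\<phi> \<equiv> std_normal_density"

definition Phi :: "real \<Rightarrow> real" where
  "Phi x = measure std_normal_distribution {..x}"

interpretation N: prob_space std_normal_distribution
  by (rule prob_space_normal_density) simp

lemma phi_eq: "\<phi> x = exp (- x\<^sup>2 / 2) / sqrt (2 * pi)"
  by (simp add: std_normal_density_def)

lemma phi_pos: "\<phi> x > 0"
  by (simp add: phi_eq)

lemma phi_minus: "\<phi> (- x) = \<phi> x"
  by (simp add: phi_eq)

lemma phi_shift: "\<phi> (x + r) = \<phi> x * exp (- x * r - r\<^sup>2 / 2)"
proof -
  have "- (x + r)\<^sup>2 / 2 = - x\<^sup>2 / 2 + (- x * r - r\<^sup>2 / 2)"
    by (simp add: power2_eq_square field_simps)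
  then show ?thesis by (simp only: phi_eq exp_add) simp
qed

lemma DERIV_phi: "(\<phi> has_real_derivative - x * \<phi> x) (at x)"
proof -
  have "((\<lambda>x. 1 / sqrt (2 * pi) * exp (- x\<^sup>2 / 2)) has_real_derivative
      1 / sqrt (2 * pi) * (exp (- x\<^sup>2 / 2) * (- (2 * x) / 2))) (at x)"
    by (intro derivative_eq_intros DERIV_cmult) (auto intro!: derivative_eq_intros)
  then show ?thesis
    by (simp add: std_normal_density_def[abs_def] mult.commute)
qed

lemma continuous_phi: "continuous_on S \<phi>"
  by (meson DERIV_isCont DERIV_phi continuous_at_imp_continuous_on)

lemma measure_normal_eq:
  assumes "A \<in> sets borel"
  shows "measure std_normal_distribution A = (\<integral>u. indicator A u * \<phi> u \<partial>lborel)"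
    and "integrable lborel (\<lambda>u. indicator A u * \<phi> u)"
proof -
  show i: "integrable lborel (\<lambda>u. indicator A u * \<phi> u)"
    using assms integrable_mult_indicator[of A lborel \<phi>] by simp
  have "measure std_normal_distribution A = (\<integral>u. indicator A u \<partial>std_normal_distribution)"
    using assms by simp
  also have "\<dots> = (\<integral>u. \<phi> u * indicator A u \<partial>lborel)"
    using assms by (subst integral_density) auto
  finally show "measure std_normal_distribution A = (\<integral>u. indicator A u * \<phi> u \<partial>lborel)"
    by (simp add: mult.commute)
qed

lemma Phi_shift_eq: "Phi (x + r) = (\<integral>u. indicator {..x} u * \<phi> (u + r) \<partial>lborel)"
proof -
  have "Phi (x + r) = (\<integral>u. indicator {..x + r} u * \<phi> u \<partial>lborel)"
    unfolding Phi_def by (rule measure_normal_eq(1)) simp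
  also have "\<dots> = (\<integral>u. indicator {..x + r} (r + 1 * u) * \<phi> (r + 1 * u) \<partial>lborel)"
    by (subst lborel_integral_real_affine[where c=1 and t=r]) auto
  also have "\<dots> = (\<integral>u. indicator {..x} u * \<phi> (u + r) \<partial>lborel)"
    by (rule Bochner_Integration.integral_cong) (auto simp: indicator_def add.commute)
  finally show ?thesis .
qed

lemma Phi_mono: "x \<le> y \<Longrightarrow> Phi x \<le> Phi y"
  unfolding Phi_def by (intro N.finite_measure_mono) auto

lemma normal_interval:
  assumes "x \<le> y"
  shows "Phi y - Phi x = integral {x..y} \<phi>"
proof -
  have "Phi y - Phi x = measure std_normal_distribution ({..y} - {..x})"
    unfolding Phi_def using assms by (subst N.finite_measure_Diff) auto
  also have "{..y} - {..x} = {x<..y}" by auto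
  also have "measure std_normal_distribution {x<..y} = (\<integral>u. indicator {x<..y} u * \<phi> u \<partial>lborel)"
    by (rule measure_normal_eq(1)) simp
  also have "\<dots> = (\<integral>u. indicator {x..y} u * \<phi> u \<partial>lborel)"
    by (rule integral_cong_AE) (use AE_lborel_singleton[of x] in \<open>auto elim!: eventually_mono simp: indicator_def\<close>)
  also have "\<dots> = integral {x..y} \<phi>"
    using integrable_mult_indicator[of "{x..y}" lborel \<phi>]
    by (subst set_borel_integral_eq_integral(2)[symmetric])
       (auto simp: set_integrable_def set_lebesgue_integral_def)
  finally show ?thesis .
qed

lemma DERIV_Phi: "(Phi has_real_derivative \<phi> x) (at x)"
proof -
  have "((\<lambda>y. integral {x - 1..y} \<phi>) has_real_derivative \<phi> x) (at x within {x - 1..x + 1})"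
    by (rule integral_has_real_derivative) (auto intro: continuous_phi)
  then have "((\<lambda>y. integral {x - 1..y} \<phi>) has_real_derivative \<phi> x) (at x)"
    by (simp add: at_within_Icc_at)
  then have "((\<lambda>y. Phi (x - 1) + integral {x - 1..y} \<phi>) has_real_derivative \<phi> x) (at x)"
    by (auto intro!: derivative_eq_intros)
  moreover have "\<forall>\<^sub>F y in nhds x. Phi (x - 1) + integral {x - 1..y} \<phi> = Phi y"
    using eventually_nhds_in_open[of "{x - 1<..<x + 1}" x]
    by (auto elim!: eventually_mono simp: normal_interval[symmetric])
  ultimately show ?thesis
    using DERIV_cong_ev[of x x "\<lambda>y. Phi (x - 1) + integral {x - 1..y} \<phi>" Phi "\<phi> x" "\<phi> x"] by simp
qed

lemmas DERIV_Phi' [derivative_intros] = DERIV_chain2[OF DERIV_Phi]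
lemmas DERIV_phi' [derivative_intros] = DERIV_chain2[OF DERIV_phi]

lemma isCont_Phi: "isCont Phi x"
  using DERIV_Phi DERIV_isCont by blast

lemma Phi_strict_mono: "x < y \<Longrightarrow> Phi x < Phi y"
  by (rule DERIV_pos_imp_increasing[of x y Phi]) (auto intro: DERIV_Phi phi_pos)

lemma Phi_nonneg: "Phi x \<ge> 0" unfolding Phi_def by simp
lemma Phi_le_1: "Phi x \<le> 1" unfolding Phi_def by simp

lemma Phi_pos: "Phi x > 0"
  using Phi_strict_mono[of "x - 1" x] Phi_nonneg[of "x - 1"] by linarith

lemma Phi_less_1: "Phi x < 1"
  using Phi_strict_mono[of x "x + 1"] Phi_le_1[of "x + 1"] by linarith

lemma Phi_less_iff: "Phi x < Phi y \<longleftrightarrow> x < y"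
  by (metis Phi_mono Phi_strict_mono linorder_not_less)

lemma Phi_le_iff: "Phi x \<le> Phi y \<longleftrightarrow> x \<le> y"
  by (meson Phi_less_iff linorder_not_less)

lemma normal_null_singleton: "measure std_normal_distribution {a} = 0"
  by (subst measure_normal_eq(1))
     (auto intro!: integral_eq_zero_AE eventually_mono[OF AE_lborel_singleton[of a]])

lemma Phi_minus: "Phi (- x) = 1 - Phi x"
proof -
  have "Phi (-x) = (\<integral>u. indicator {..-x} u * \<phi> u \<partial>lborel)"
    unfolding Phi_def by (rule measure_normal_eq(1)) simp
  also have "\<dots> = (\<integral>u. indicator {..-x} (0 + (-1) * u) * \<phi> (0 + (-1) * u) \<partial>lborel)"
    by (subst lborel_integral_real_affine[where c="-1" and t=0]) auto
  also have "\<dots> = (\<integral>u. indicator {x..} u * \<phi> u \<partial>lborel)"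
    by (rule Bochner_Integration.integral_cong) (auto simp: indicator_def phi_eq)
  also have "\<dots> = measure std_normal_distribution {x..}"
    by (rule measure_normal_eq(1)[symmetric]) simp
  also have "{x..} = UNIV - {..x} \<union> {x}" by auto
  also have "measure std_normal_distribution \<dots> = measure std_normal_distribution (UNIV - {..x})"
    by (subst N.finite_measure_Union) (auto simp: normal_null_singleton)
  also have "\<dots> = 1 - Phi x"
    unfolding Phi_def using N.prob_compl[of "{..x}"] by simp
  finally show ?thesis .
qed

lemma Phi_0: "Phi 0 = 1/2"
  using Phi_minus[of 0] by simp

lemma Phi_at_top: "(Phi \<longlongrightarrow> 1) at_top"
proof -
  interpret R: real_distribution std_normal_distribution
    by (rule real_dist_normal_dist)
  have "Phi = cdf std_normal_distribution" by (auto simp: Phi_def cdf_def)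
  then show ?thesis using R.cdf_lim_at_top_prob by simp
qed

lemma Phi_at_bot: "(Phi \<longlongrightarrow> 0) at_bot"
proof -
  interpret R: real_distribution std_normal_distribution
    by (rule real_dist_normal_dist)
  have "Phi = cdf std_normal_distribution" by (auto simp: Phi_def cdf_def)
  then show ?thesis using R.cdf_lim_at_bot by simp
qed

lemma Phi_surj:
  assumes "0 < p" "p < 1"
  obtains x where "Phi x = p"
proof -
  have "\<forall>\<^sub>F x in at_bot. Phi x < p" using Phi_at_bot assms by (simp add: order_tendstoD)
  then obtain l where l: "Phi l < p" by (metis eventually_at_bot_linorder order_refl)
  have "\<forall>\<^sub>F x in at_top. Phi x > p" using Phi_at_top assms by (simp add: order_tendstoD)
  then obtain u where u: "Phi u > p" by (metis eventually_at_top_linorder order_refl)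
  have "l \<le> u" using l u by (meson Phi_less_iff less_trans order_less_imp_le)
  then show ?thesis
    using IVT'[of Phi l p u] l u isCont_Phi that by (meson continuous_at_imp_continuous_on less_imp_le)
qed

text \<open>By \<open>phi_shift\<close> the shifted density is \<open>\<phi> u\<close> times
  \<open>exp (- u * r - r\<^sup>2 / 2)\<close>, and over \<open>u \<le> x\<close> this factor is
  smallest at \<open>u = x\<close>. Both the log-concavity of \<open>Phi\<close> and its tail bound
  come from this estimate.\<close>

lemma Phi_shift:
  assumes "r \<ge> 0"
  shows "Phi x * exp (- x * r - r\<^sup>2 / 2) \<le> Phi (x + r)"
proof -
  have i: "integrable lborel (\<lambda>u. indicator {..x} u * \<phi> u)" by (rule measure_normal_eq(2)) simp
  have i2: "integrable lborel (\<lambda>u. indicator {..x + r} (r + 1 * u) * \<phi> (r + 1 * u))"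
    by (subst lborel_integrable_real_affine_iff) (auto intro: measure_normal_eq(2))
  have "Phi x * exp (- x * r - r\<^sup>2 / 2) = (\<integral>u. indicator {..x} u * \<phi> u \<partial>lborel) * exp (- x * r - r\<^sup>2 / 2)"
    unfolding Phi_def by (subst measure_normal_eq(1)) auto
  also have "\<dots> = (\<integral>u. indicator {..x} u * \<phi> u * exp (- x * r - r\<^sup>2 / 2) \<partial>lborel)"
    by simp
  also have "\<dots> \<le> (\<integral>u. indicator {..x} u * \<phi> (u + r) \<partial>lborel)"
  proof (rule integral_mono)
    show "integrable lborel (\<lambda>u. indicator {..x} u * \<phi> u * exp (- x * r - r\<^sup>2 / 2))"
      using i by simp
    show "integrable lborel (\<lambda>u. indicator {..x} u * \<phi> (u + r))"
      using i2 by (rule Bochner_Integration.integrable_cong[THEN iffD1, rotated -1]) (auto simp: indicator_def add.commute)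
    fix u
    show "indicator {..x} u * \<phi> u * exp (- x * r - r\<^sup>2 / 2) \<le> indicator {..x} u * \<phi> (u + r)"
      using assms by (auto simp: indicator_def phi_shift intro!: mult_left_mono mult_right_mono)
  qed
  also have "\<dots> = Phi (x + r)" by (rule Phi_shift_eq[symmetric])
  finally show ?thesis .
qed

text \<open>Log-concavity of \<open>Phi\<close>: by \<open>Phi_shift\<close> the derivative of
  \<open>Phi (x + r) / Phi x\<close> is nonpositive. For half-lines it says that the relative gain
  from an enlargement by \<open>r\<close> decreases as the half-line grows.\<close>

lemma Phi_ratio_antimono:
  assumes "r \<ge> 0" "b \<le> a"
  shows "Phi (a + r) * Phi b \<le> Phi (b + r) * Phi a"
proof -
  have "Phi (a + r) / Phi a \<le> Phi (b + r) / Phi b"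
  proof (rule DERIV_nonpos_imp_nonincreasing[OF assms(2)])
    fix x
    have "((\<lambda>x. Phi (x + r) / Phi x) has_real_derivative
       (\<phi> (x + r) * Phi x - Phi (x + r) * \<phi> x) / (Phi x * Phi x)) (at x)"
      using Phi_pos[of x] by (auto intro!: derivative_eq_intros)
    moreover have "\<phi> (x + r) * Phi x \<le> Phi (x + r) * \<phi> x"
      using mult_left_mono[OF Phi_shift[OF assms(1), of x], of "\<phi> x"] phi_pos[of x]
      by (simp add: phi_shift mult_ac)
    ultimately show "\<exists>y. ((\<lambda>x. Phi (x + r) / Phi x) has_real_derivative y) (at x) \<and> y \<le> 0"
      using Phi_pos[of x] by (intro exI conjI) (auto simp: divide_nonpos_pos)
  qed
  then show ?thesis using Phi_pos[of a] Phi_pos[of b] by (simp add: field_simps)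
qed

text \<open>Shift \<open>- x\<close> to \<open>0\<close>, where \<open>Phi\<close> is
  \<open>1/2\<close>. This factor matters: two such tails together stay below
  \<open>exp (- x\<^sup>2 / 2)\<close>.\<close>

lemma Phi_tail:
  assumes "x \<ge> 0"
  shows "Phi (- x) \<le> exp (- x\<^sup>2 / 2) / 2"
proof -
  have "Phi (-x) * exp (x\<^sup>2 / 2) \<le> 1/2"
    using Phi_shift[OF assms, of "-x"] by (simp add: Phi_0 power2_eq_square)
  then show ?thesis by (simp add: exp_minus field_simps)
qed

text \<open>This is the expectation of \<open>max (g - a) 0\<close> for a standard normal variable \<open>g\<close>.\<close>

definition psi :: "real \<Rightarrow> real" where "psi a = \<phi> a - a * Phi (- a)"

lemma DERIV_psi [derivative_intros]: "(psi has_real_derivative - Phi (- a)) (at a)"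
  unfolding psi_def[abs_def] by (auto intro!: derivative_eq_intros simp: phi_minus)


lemma normal_expectation_eq: "(\<integral>x. h x \<partial>std_normal_distribution) = (\<integral>x. \<phi> x * h x \<partial>lborel)"
  if "h \<in> borel_measurable borel" for h :: "real \<Rightarrow> real"
  using that by (subst integral_density) auto

lemma integrable_normal_id: "integrable std_normal_distribution (\<lambda>x. x)"
  using integrable_std_normal_moment[of 1] by (subst integrable_density) auto

lemma normal_first_moment_tail:
  "(\<integral>x. indicator {a..} x * x \<partial>std_normal_distribution) = \<phi> a"
proof -
  have i: "integrable lborel (\<lambda>x. \<phi> x * x)" using integrable_std_normal_moment[of 1] by simp
  have "((\<lambda>x. \<phi> x) \<longlongrightarrow> 0) at_top"
    unfolding phi_eq by real_asymp
  then have lim: "(((\<lambda>x. - \<phi> x) \<circ> real_of_ereal) \<longlongrightarrow> 0) (at_left \<infinity>)"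
    unfolding ereal_tendsto_simps using tendsto_minus[of \<phi> 0 at_top] by simp
  have "(LBINT x=ereal a..\<infinity>. \<phi> x * x) = 0 - (- \<phi> a)"
  proof (rule interval_integral_FTC_integrable)
    show "((\<lambda>x. - \<phi> x) has_vector_derivative \<phi> x * x) (at x)" for x
      by (auto simp flip: has_real_derivative_iff_has_vector_derivative intro!: derivative_eq_intros)
    show "isCont (\<lambda>x. \<phi> x * x) x" for x
      using DERIV_isCont[OF DERIV_phi] by (auto intro!: continuous_intros)
    show "set_integrable lborel (einterval (ereal a) \<infinity>) (\<lambda>x. \<phi> x * x)"
      unfolding set_integrable_def using i by (intro integrable_mult_indicator) auto
    show "(((\<lambda>x. - \<phi> x) \<circ> real_of_ereal) \<longlongrightarrow> - \<phi> a) (at_right (ereal a))"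
      unfolding ereal_tendsto_simps
      by (intro tendsto_minus filterlim_mono[OF isContD[OF DERIV_isCont[OF DERIV_phi]] order_refl at_le]) simp
  qed (use lim in auto)
  then have *: "(LINT x:{a<..}|lborel. \<phi> x * x) = \<phi> a"
    by (simp add: interval_lebesgue_integral_def)
  have "(\<integral>x. indicator {a..} x * x \<partial>std_normal_distribution) = (\<integral>x. \<phi> x * (indicator {a..} x * x) \<partial>lborel)"
    by (rule normal_expectation_eq) simp
  also have "\<dots> = (LINT x:{a<..}|lborel. \<phi> x * x)"
    unfolding set_lebesgue_integral_def
    by (rule integral_cong_AE) (auto intro!: eventually_mono[OF AE_lborel_singleton[of a]] simp: indicator_def)
  finally show ?thesis using * by simp
qed

lemma measure_normal_atLeast: "measure std_normal_distribution {a..} = Phi (- a)"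
proof -
  have "{a..} = UNIV - {..a} \<union> {a}" by auto
  also have "measure std_normal_distribution \<dots> = measure std_normal_distribution (UNIV - {..a})"
    by (subst N.finite_measure_Union) (auto simp: normal_null_singleton)
  also have "\<dots> = 1 - Phi a"
    unfolding Phi_def using N.prob_compl[of "{..a}"] by simp
  finally show ?thesis by (simp add: Phi_minus)
qed

lemma normal_positive_part: "(\<integral>x. max (x - a) 0 \<partial>std_normal_distribution) = psi a"
proof -
  have "(\<integral>x. max (x - a) 0 \<partial>std_normal_distribution)
     = (\<integral>x. indicator {a..} x * x - indicator {a..} x * a \<partial>std_normal_distribution)"
    by (rule Bochner_Integration.integral_cong) (auto simp: indicator_def)
  also have "\<dots> = (\<integral>x. indicator {a..} x * x \<partial>std_normal_distribution)
      - (\<integral>x. indicator {a..} x * a \<partial>std_normal_distribution)"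
    using integrable_normal_id
    by (intro Bochner_Integration.integral_diff integrable_real_mult_indicator
          integrable_mult_right integrable_mult_indicator[where 'b=real, simplified]) (auto simp: mult.commute)
  also have "\<dots> = psi a"
    by (simp add: normal_first_moment_tail measure_normal_atLeast psi_def)
  finally show ?thesis .
qed

lemma psi_nonneg: "psi a \<ge> 0"
  unfolding normal_positive_part[symmetric] by (rule integral_nonneg_AE) simp

text \<open>The average of \<open>max y 0 = y + max (- y) 0\<close> for \<open>y = g + m\<close>,
  combined with the symmetry of \<open>g\<close>.\<close>

lemma psi_minus: "psi (- m) = m + psi m"
  by (simp add: psi_def Phi_minus phi_minus algebra_simps)

lemma psi_antimono: "a \<le> b \<Longrightarrow> psi b \<le> psi a"
  by (rule DERIV_nonpos_imp_nonincreasing[of a b psi]) (auto intro!: derivative_intros simp: Phi_nonneg)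

section \<open>The two-sided tail inequality between \<open>a\<close> and \<open>t\<close>\<close>

lemma phi_0: "\<phi> 0 = 1 / sqrt (2 * pi)"
  by (simp add: phi_eq)

lemma phi_0_upper: "\<phi> 0 \<le> 41 / 100"
proof -
  have "(100/41)\<^sup>2 \<le> 2 * pi" using pi_gt3 by (simp add: power2_eq_square)
  then have "100/41 \<le> sqrt (2 * pi)" by (rule real_le_rsqrt)
  then show ?thesis by (simp add: phi_0 field_simps)
qed

lemma phi_0_lower: "\<phi> 0 \<ge> 35 / 100"
proof -
  have "2 * pi \<le> (100/35)\<^sup>2" using pi_less_4 by (simp add: power2_eq_square)
  then have "sqrt (2 * pi) \<le> 100/35" by (intro real_le_lsqrt) auto
  then show ?thesis by (simp add: phi_0 field_simps)
qed

lemma phi_antimono: "0 \<le> x \<Longrightarrow> x \<le> y \<Longrightarrow> \<phi> y \<le> \<phi> x"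
  by (auto simp: phi_eq intro!: divide_right_mono)

text \<open>The left-hand side is 1 minus the mass of the gap between \<open>a\<close> and
  \<open>a + 2 * t\<close>, so that mass has to be at least \<open>t\<^sup>2 / 2\<close>. Since
  \<open>t \<le> psi a \<le> \<phi> a\<close>, and the density drops by at most a factor 3 across
  the gap, the mass is at least \<open>2 * t * (t / 3)\<close>.\<close>

lemma two_sided_tail_pos:
  assumes "a \<ge> 0" "t > 0" "t \<le> psi a"
  shows "Phi a + Phi (- a - 2 * t) \<le> exp (- t\<^sup>2 / 2)"
proof -
  have t: "t \<le> \<phi> a"
    using assms mult_nonneg_nonneg[OF assms(1) Phi_nonneg[of "- a"]] unfolding psi_def by linarith
  then have t1: "t \<le> 41/100"
    using phi_antimono[of 0 a] phi_0_upper assms by simp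
  have e: "\<phi> a * exp (a\<^sup>2 / 2) = \<phi> 0"
    by (simp add: phi_eq exp_minus)
  \<comment> \<open>\<open>7/5\<close> is a rational just below \<open>sqrt 2\<close>, the best
    constant here. It bounds \<open>a * \<phi> a\<close>, and thereby \<open>a * t\<close>, so that
    the exponent \<open>2 * a * t + 2 * t\<^sup>2\<close> of the density quotient is at most
    1.\<close>
  have "7/5 * a \<le> 1 + a\<^sup>2 / 2"
    using zero_le_power2[of "a - 7/5"] by (simp add: power2_eq_square algebra_simps)
  also have "\<dots> \<le> exp (a\<^sup>2 / 2)" by (rule exp_ge_add_one_self)
  finally have "\<phi> a * (7/5 * a) \<le> \<phi> 0"
    using mult_left_mono[of "7/5 * a" "exp (a\<^sup>2/2)" "\<phi> a"] phi_pos[of a] e by simp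
  then have "a * t \<le> 41/100 * (5/7)"
    using mult_left_mono[OF t assms(1)] phi_0_upper by (simp add: mult_ac)
  moreover have "t\<^sup>2 \<le> (41/100)\<^sup>2" using t1 assms by (intro power_mono) auto
  ultimately have x: "2 * a * t + 2 * t\<^sup>2 \<le> 1" by (simp add: power2_eq_square)
  have "exp (- 1) \<ge> (1/3 :: real)" using exp_le by (simp add: exp_minus field_simps)
  then have "exp (- (2 * a * t + 2 * t\<^sup>2)) \<ge> 1/3"
    using x by (smt (verit) exp_le_cancel_iff)
  then have "\<phi> (a + 2 * t) \<ge> \<phi> a * (1/3)"
    unfolding phi_shift using phi_pos[of a] by (intro mult_left_mono) (auto simp: power2_eq_square algebra_simps)
  then have p: "\<phi> (a + 2 * t) \<ge> t / 3" using t by simp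
  obtain z where z: "z > a" "z < a + 2 * t" "Phi (a + 2 * t) - Phi a = (a + 2 * t - a) * \<phi> z"
    using MVT2[of a "a + 2 * t" Phi \<phi>] assms DERIV_Phi by auto
  have "\<phi> z \<ge> t/3" using z p phi_antimono[of z "a + 2 * t"] assms by simp
  then have "Phi (a + 2 * t) - Phi a \<ge> 2 * t * (t / 3)"
    using z assms by simp
  moreover have "2 * t * (t / 3) \<ge> t\<^sup>2 / 2" by (simp add: power2_eq_square)
  moreover have "exp (- t\<^sup>2 / 2) \<ge> 1 - t\<^sup>2 / 2" using exp_ge_add_one_self[of "- t\<^sup>2 / 2"] by simp
  moreover have "Phi (- a - 2 * t) = 1 - Phi (a + 2 * t)"
    using Phi_minus[of "a + 2 * t"] by simp
  ultimately show ?thesis by linarith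
qed

lemma sinh_le_cosh:
  assumes "x \<ge> 0"
  shows "sinh x \<le> x * cosh (x::real)"
proof -
  have "(\<lambda>x. x * cosh x - sinh x) (0::real) \<le> (\<lambda>x. x * cosh x - sinh x) x"
  proof (rule DERIV_nonneg_imp_nondecreasing[OF assms])
    fix y :: real assume "0 \<le> y"
    then show "\<exists>d. ((\<lambda>x. x * cosh x - sinh x) has_real_derivative d) (at y) \<and> 0 \<le> d"
      by (intro exI[of _ "y * sinh y"]) (auto intro!: derivative_eq_intros)
  qed
  then show ?thesis by simp
qed

lemma cosh_le_exp_square:
  assumes "x \<ge> 0"
  shows "cosh x \<le> exp (x\<^sup>2 / 2 :: real)"
proof -
  have "(\<lambda>x. cosh x * exp (- (x\<^sup>2 / 2))) x \<le> (\<lambda>x. cosh x * exp (- (x\<^sup>2 / 2))) (0::real)"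
  proof (rule DERIV_nonpos_imp_nonincreasing[OF assms])
    fix y :: real assume y: "0 \<le> y"
    have "((\<lambda>x. cosh x * exp (- (x\<^sup>2 / 2))) has_real_derivative (sinh y - y * cosh y) * exp (- (y\<^sup>2 / 2))) (at y)"
      by (auto intro!: derivative_eq_intros simp: algebra_simps)
    then show "\<exists>d. ((\<lambda>x. cosh x * exp (- (x\<^sup>2 / 2))) has_real_derivative d) (at y) \<and> d \<le> 0"
      using sinh_le_cosh[OF y] by (intro exI conjI) (auto intro!: mult_nonpos_nonneg)
  qed
  then show ?thesis by (simp add: exp_minus field_simps)
qed

lemma psi_0: "psi 0 = \<phi> 0" by (simp add: psi_def)

text \<open>The lower bound is the tangent at \<open>0\<close> of the convex function
  \<open>psi\<close>.\<close>

lemma psi_lower: "0 \<le> x \<Longrightarrow> psi x \<ge> \<phi> 0 - x / 2"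
proof -
  assume x: "0 \<le> x"
  have "(\<lambda>x. psi x + x / 2) 0 \<le> (\<lambda>x. psi x + x / 2) x"
  proof (rule DERIV_nonneg_imp_nondecreasing[OF x])
    fix y :: real assume "0 \<le> y"
    then have "Phi (- y) \<le> 1/2" using Phi_mono[of "-y" 0] by (simp add: Phi_0)
    then show "\<exists>d. ((\<lambda>x. psi x + x / 2) has_real_derivative d) (at y) \<and> 0 \<le> d"
      by (intro exI[of _ "1/2 - Phi (- y)"]) (auto intro!: derivative_eq_intros)
  qed
  then show ?thesis by (simp add: psi_0)
qed

text \<open>With \<open>1 - u \<le> exp (- u)\<close> this gives \<open>2 * Phi (- m) \<le> exp (- (m + psi m)\<^sup>2 / 2)\<close>, where
  \<open>m + psi m = psi (- m)\<close> is the largest admissible \<open>t\<close>. It fails for \<open>m = 0\<close>.\<close>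

lemma mills_ratio_bound:
  assumes "m \<ge> 1/2"
  shows "2 * Phi (- m) * exp (m\<^sup>2 / 2) + (m * psi m + (psi m)\<^sup>2 / 2) \<le> 1"
proof -
  define S where "S m = 2 * Phi (- m) * exp (m\<^sup>2 / 2) + (m * psi m + (psi m)\<^sup>2 / 2)" for m
  define S' where "S' m = - 2 * \<phi> m * exp (m\<^sup>2 / 2) + 2 * Phi (- m) * exp (m\<^sup>2 / 2) * m
     + psi m - m * Phi (- m) - psi m * Phi (- m)" for m
  have D: "(S has_real_derivative S' y) (at y)" for y
    unfolding S_def[abs_def] S'_def
    by (auto intro!: derivative_eq_intros simp: phi_minus algebra_simps)
  have S'_le: "S' y \<le> - psi y" if "y \<ge> 0" for y
  proof -
    have "S' y = - 2 * psi y * exp (y\<^sup>2 / 2) + psi y - (y + psi y) * Phi (- y)"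
      unfolding S'_def by (simp add: psi_def algebra_simps)
    moreover have "psi y * exp (y\<^sup>2 / 2) \<ge> psi y * 1" by (intro mult_left_mono psi_nonneg) simp
    moreover have "(y + psi y) * Phi (- y) \<ge> 0" using that psi_nonneg Phi_nonneg by simp
    ultimately show ?thesis by linarith
  qed
  have "S m \<le> S (1/2)"
  proof (rule DERIV_nonpos_imp_nonincreasing[OF assms])
    fix y :: real assume "1/2 \<le> y"
    then show "\<exists>d. (S has_real_derivative d) (at y) \<and> d \<le> 0"
      using D[of y] S'_le[of y] psi_nonneg[of y] by (intro exI[of _ "S' y"]) auto
  qed
  \<comment> \<open>At \<open>0\<close> the value exceeds 1 by
    \<open>(\<phi> 0)\<^sup>2 / 2\<close>. Since the slope is at most \<open>- psi y\<close>, hence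
    at most \<open>y / 2 - \<phi> 0\<close>, the decrease on the way to \<open>1/2\<close> is at
    least \<open>\<phi> 0 / 2 - 1 / 16\<close>, which outweighs that excess.\<close>
  moreover have "(\<lambda>y. S y + \<phi> 0 * y - y\<^sup>2 / 4) (1/2) \<le> (\<lambda>y. S y + \<phi> 0 * y - y\<^sup>2 / 4) 0"
  proof (rule DERIV_nonpos_imp_nonincreasing[of 0 "1/2"])
    fix y :: real assume "0 \<le> y"
    then show "\<exists>d. ((\<lambda>y. S y + \<phi> 0 * y - y\<^sup>2 / 4) has_real_derivative d) (at y) \<and> d \<le> 0"
      using S'_le[of y] psi_lower[of y]
      by (intro exI[of _ "S' y + \<phi> 0 - y / 2"]) (auto intro!: derivative_eq_intros D)
  qed simp
  then have "S (1/2) \<le> S 0 - \<phi> 0 / 2 + 1 / 16" by (simp add: power2_eq_square)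
  moreover have "S 0 = 1 + (\<phi> 0)\<^sup>2 / 2" by (simp add: S_def psi_0 Phi_0)
  moreover have "(\<phi> 0)\<^sup>2 \<le> (41/100)\<^sup>2"
    using phi_0_upper phi_pos[of 0] by (intro power_mono) auto
  ultimately have "S m \<le> 1" using phi_0_lower by (simp add: power2_eq_square)
  then show ?thesis by (simp add: S_def)
qed

text \<open>For \<open>a < 0\<close> the tails begin at distances \<open>m = - a\<close> and
  \<open>2 * t - m\<close> from the origin, symmetric about \<open>t\<close>. If
  \<open>t \<le> 1\<close>, Gaussian tail bounds for each suffice. If \<open>t > 1\<close>, both are
  replaced by the larger one, and \<open>t \<le> m + psi m\<close> forces \<open>m\<close> to be
  large enough for \<open>mills_ratio_bound\<close>.\<close>

lemma two_sided_tail: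
  assumes "t > 0" "t \<le> psi a" "t \<ge> - a"
  shows "Phi a + Phi (- a - 2 * t) \<le> exp (- t\<^sup>2 / 2)"
proof (cases "a \<ge> 0")
  case True
  then show ?thesis using two_sided_tail_pos assms by blast
next
  case False
  define m where "m = - a"
  have m: "m > 0" "t \<ge> m" "t \<le> m + psi m"
    using False assms by (auto simp: m_def simp flip: psi_minus)
  show ?thesis
  proof (cases "t \<le> 1")
    case True
    define c where "c = t - m"
    have c: "c \<ge> 0" "c \<le> t" using m by (auto simp: c_def)
    have "Phi a + Phi (- a - 2 * t) = Phi (- (t - c)) + Phi (- (t + c))"
      by (simp add: c_def m_def diff_diff_eq2 minus_diff_commute)
    also have "\<dots> \<le> exp (- (t - c)\<^sup>2 / 2) / 2 + exp (- (t + c)\<^sup>2 / 2) / 2"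
      using c assms by (intro add_mono Phi_tail) auto
    also have "\<dots> = exp (- t\<^sup>2 / 2) * exp (- c\<^sup>2 / 2) * cosh (t * c)"
    proof -
      have "exp (- (t - c)\<^sup>2 / 2) = exp (- t\<^sup>2 / 2) * exp (- c\<^sup>2 / 2) * exp (t * c)"
        "exp (- (t + c)\<^sup>2 / 2) = exp (- t\<^sup>2 / 2) * exp (- c\<^sup>2 / 2) * exp (- (t * c))"
        by (simp_all flip: exp_add) (simp_all add: power2_eq_square field_simps)
      then show ?thesis
        by (simp add: cosh_field_def algebra_simps add_divide_distrib)
    qed
    \<comment> \<open>The gain \<open>exp (- c\<^sup>2 / 2)\<close> from the squares pays for the
      cross terms collected in \<open>cosh (t * c)\<close>, exactly because
      \<open>t \<le> 1\<close>.\<close>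
    also have "\<dots> \<le> exp (- t\<^sup>2 / 2) * exp (- c\<^sup>2 / 2) * exp (c\<^sup>2 / 2)"
    proof -
      have "(t * c)\<^sup>2 \<le> c\<^sup>2"
        using True assms c by (intro power_mono mult_left_le_one_le) auto
      then have "cosh (t * c) \<le> exp (c\<^sup>2 / 2)"
        using cosh_le_exp_square[of "t * c"] assms c by (smt (verit) exp_le_cancel_iff divide_right_mono mult_nonneg_nonneg)
      then show ?thesis by (intro mult_left_mono) auto
    qed
    also have "\<dots> = exp (- t\<^sup>2 / 2)" by (simp add: exp_minus)
    finally show ?thesis .
  next
    case False
    have "psi m \<le> 41/100" using psi_antimono[of 0 m] m phi_0_upper by (simp add: psi_0)
    then have m12: "m \<ge> 1/2" using m False by linarith
    define u where "u = m * psi m + (psi m)\<^sup>2 / 2"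
    have "2 * Phi (- m) * exp (m\<^sup>2 / 2) \<le> 1 - u"
      using mills_ratio_bound[OF m12] by (simp add: u_def)
    also have "\<dots> \<le> exp (- u)" using exp_ge_add_one_self[of "-u"] by simp
    finally have *: "2 * Phi (- m) \<le> exp (- (m\<^sup>2 / 2)) * exp (- u)"
      by (simp add: exp_minus field_simps)
    have "Phi a + Phi (- a - 2 * t) \<le> 2 * Phi (- m)"
      using Phi_mono[of "-a - 2*t" "-m"] m by (simp add: m_def)
    also note *
    also have "exp (- (m\<^sup>2 / 2)) * exp (- u) = exp (- (m + psi m)\<^sup>2 / 2)"
      by (simp add: u_def flip: exp_add) (simp add: power2_eq_square algebra_simps add_divide_distrib)
    also have "\<dots> \<le> exp (- t\<^sup>2 / 2)"
      using m by (simp add: power_mono)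
    finally show ?thesis .
  qed
qed


section \<open>Deviation of monotone Lipschitz functions on the line\<close>

lemma lower_level_set:
  fixes T :: "real \<Rightarrow> real"
  assumes mono: "mono T" and lip: "1-lipschitz_on UNIV T"
    and mean: "(\<integral>x. T x \<partial>std_normal_distribution) = 0"
    and int: "integrable std_normal_distribution T" and t: "t > 0"
  shows "{x. T x \<le> - t} = {} \<or> (\<exists>a. {x. T x \<le> - t} = {..a} \<and> t \<le> psi a)"
proof (cases "{x. T x \<le> - t} = {}")
  case False
  let ?A = "{x. T x \<le> - t}"
  have cont: "continuous_on UNIV T" using lip by (rule lipschitz_on_continuous_on)
  have "\<exists>u. T u > - t"
  proof (rule ccontr)
    assume "\<not> ?thesis"
    then have "(\<integral>x. T x \<partial>std_normal_distribution) \<le> (\<integral>x. - t \<partial>std_normal_distribution)"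
      using int by (intro integral_mono) (auto simp: not_less)
    then show False using mean t N.prob_space by simp
  qed
  then obtain u where u: "T u > - t" by blast
  have bdd: "bdd_above ?A"
  proof (rule bdd_aboveI)
    show "x \<le> u" if "x \<in> ?A" for x
      using that u monoD[OF mono, of u x] by (cases "u \<le> x") auto
  qed
  have closed: "closed ?A"
    using cont by (intro closed_Collect_le continuous_intros) auto
  define a where "a = Sup ?A"
  have a: "T a \<le> - t"
    using closed_contains_Sup[OF False bdd closed] by (simp add: a_def)
  have A: "?A = {..a}"
    using cSup_upper[OF _ bdd] a mono by (force simp: a_def mono_def)
  have le: "T x \<le> max (x - a) 0 - t" for x
  proof (cases "x \<le> a")
    case True then show ?thesis using a monoD[OF mono, of x a] by simp
  next
    case False
    have "\<bar>T x - T a\<bar> \<le> \<bar>x - a\<bar>" using lipschitz_onD[OF lip, of x a] by (simp add: dist_real_def)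
    then show ?thesis using False a by simp
  qed
  have i: "integrable std_normal_distribution (\<lambda>x. max (x - a) 0)"
    using integrable_normal_id by (intro integrable_max) auto
  have "(\<integral>x. T x \<partial>std_normal_distribution) \<le> (\<integral>x. max (x - a) 0 - t \<partial>std_normal_distribution)"
    using int i le by (intro integral_mono) auto
  also have "\<dots> = psi a - t" using i normal_positive_part[of a] N.prob_space by simp
  finally show ?thesis using A mean by auto
qed auto

lemma normal_expectation_uminus:
  "(\<integral>x. h (- x) \<partial>std_normal_distribution) = (\<integral>x. h x \<partial>std_normal_distribution)"
  "integrable std_normal_distribution h \<Longrightarrow> integrable std_normal_distribution (\<lambda>x. h (- x))"
  if [measurable]: "h \<in> borel_measurable borel" for h :: "real \<Rightarrow> real"
proof -
  have "(\<integral>x. h x \<partial>std_normal_distribution) = (\<integral>x. \<phi> x * h x \<partial>lborel)"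
    by (rule normal_expectation_eq) simp
  also have "\<dots> = (\<integral>x. \<phi> (0 + (-1) * x) * h (0 + (-1) * x) \<partial>lborel)"
    by (subst lborel_integral_real_affine[where c="-1" and t=0]) auto
  also have "\<dots> = (\<integral>x. h (- x) \<partial>std_normal_distribution)"
    by (simp add: phi_minus normal_expectation_eq)
  finally show "(\<integral>x. h (- x) \<partial>std_normal_distribution) = (\<integral>x. h x \<partial>std_normal_distribution)" by simp
  assume "integrable std_normal_distribution h"
  then have "integrable lborel (\<lambda>x. \<phi> x * h x)" by (subst (asm) integrable_density) auto
  then have "integrable lborel (\<lambda>x. \<phi> (0 + (-1) * x) * h (0 + (-1) * x))"
    by (subst lborel_integrable_real_affine_iff) auto
  then show "integrable std_normal_distribution (\<lambda>x. h (- x))"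
    by (subst integrable_density) (auto simp: phi_minus)
qed

text \<open>The reflection \<open>T'\<close> turns the upper level set into a lower one, so both end
  points \<open>a\<close> and \<open>b\<close> satisfy the same constraint from the mean and their
  roles can be exchanged. The Lipschitz condition then bounds the second tail by the one in
  \<open>two_sided_tail\<close>.\<close>

lemma real_lipschitz_deviation:
  fixes T :: "real \<Rightarrow> real"
  assumes mono: "mono T" and lip: "1-lipschitz_on UNIV T"
    and mean: "(\<integral>x. T x \<partial>std_normal_distribution) = 0"
    and int: "integrable std_normal_distribution T" and t: "t > 0"
  shows "measure std_normal_distribution {x. \<bar>T x\<bar> \<ge> t} \<le> exp (- t\<^sup>2 / 2)"
proof -
  define T' where "T' x = - T (- x)" for x
  have [measurable]: "T \<in> borel_measurable borel"
    using lipschitz_on_continuous_on[OF lip] by (rule borel_measurable_continuous_onI)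
  have T': "{x. T' x \<le> - t} = {} \<or> (\<exists>a. {x. T' x \<le> - t} = {..a} \<and> t \<le> psi a)"
  proof (rule lower_level_set)
    show "mono T'" using mono by (auto simp: mono_def T'_def)
    show "1-lipschitz_on UNIV T'"
    proof (rule lipschitz_onI)
      show "dist (T' x) (T' y) \<le> 1 * dist x y" for x y
        using lipschitz_onD[OF lip, of "- x" "- y"] by (simp add: T'_def dist_minus)
    qed simp
    show "(\<integral>x. T' x \<partial>std_normal_distribution) = 0"
      using normal_expectation_uminus(1)[of T] mean by (simp add: T'_def)
    show "integrable std_normal_distribution T'"
      using normal_expectation_uminus(2)[of T] int unfolding T'_def[abs_def] by simp
  qed fact
  define p where "p = measure std_normal_distribution {x. T x \<le> - t}"
  define q where "q = measure std_normal_distribution {x. T x \<ge> t}"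
  have "measure std_normal_distribution {x. \<bar>T x\<bar> \<ge> t} = measure std_normal_distribution ({x. T x \<le> - t} \<union> {x. T x \<ge> t})"
    by (rule arg_cong[where f="measure _"]) auto
  also have "\<dots> = p + q"
    unfolding p_def q_def using t by (subst N.finite_measure_Union) auto
  finally have pq: "measure std_normal_distribution {x. \<bar>T x\<bar> \<ge> t} = p + q" .
  have p: "p = 0 \<or> (\<exists>a. {x. T x \<le> - t} = {..a} \<and> t \<le> psi a \<and> p = Phi a)"
    using lower_level_set[OF assms] unfolding p_def Phi_def by auto
  have "{x. T x \<ge> t} = uminus -` {x. T' x \<le> - t}"
    by (auto simp: T'_def)
  moreover have "uminus -` {..b} = {- b..}" for b :: real
    by auto
  ultimately have q: "q = 0 \<or> (\<exists>b. {x. T x \<ge> t} = {- b..} \<and> t \<le> psi b \<and> q = Phi b)"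
    using T' unfolding q_def
    by (elim disjE exE conjE) (simp_all only: vimage_empty measure_empty measure_normal_atLeast minus_minus, auto)
  \<comment> \<open>Covers the case that one of the level sets is empty, as happens for a bounded
    \<open>T\<close>.\<close>
  have one: "Phi a \<le> exp (- t\<^sup>2 / 2)" if "t \<le> psi a" for a
  proof (cases "t \<ge> - a")
    case True
    then show ?thesis using two_sided_tail[OF t that] Phi_nonneg[of "- a - 2 * t"] by linarith
  next
    case False
    then have "Phi a \<le> Phi (- t)" by (intro Phi_mono) simp
    then show ?thesis using Phi_tail[of t] t by (simp add: field_simps) (smt (verit) exp_gt_zero)
  qed
  show ?thesis
  proof (cases "p = 0 \<or> q = 0")
    case True
    then show ?thesis using one p q unfolding pq by auto
  next
    case False
    then obtain a b where a: "{x. T x \<le> - t} = {..a}" "t \<le> psi a" "p = Phi a"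
      and b: "{x. T x \<ge> t} = {- b..}" "t \<le> psi b" "q = Phi b" using p q by blast
    have "T a \<le> - t" "T (- b) \<ge> t" using a(1) b(1) by blast+
    moreover from this have "- b \<ge> a" using mono t by (smt (verit) monoD)
    ultimately have ab: "2 * t \<le> - b - a"
      using lipschitz_onD[OF lip, of "- b" a] by (simp add: dist_real_def)
    \<comment> \<open>\<open>two_sided_tail\<close> applies from whichever side has its end point at
      distance at most \<open>t\<close> on its own side of the origin or beyond it. If neither has,
      each tail is at most half of the bound by \<open>Phi_tail\<close>.\<close>
    consider "t \<ge> - a" | "t \<ge> - b" | "a \<le> - t" "b \<le> - t" by linarith
    then show ?thesis
    proof cases
      case 1
      have "Phi b \<le> Phi (- a - 2 * t)" using ab by (intro Phi_mono) simp
      then show ?thesis using two_sided_tail[OF t a(2) 1] pq a b by simp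
    next
      case 2
      have "Phi a \<le> Phi (- b - 2 * t)" using ab by (intro Phi_mono) simp
      then show ?thesis using two_sided_tail[OF t b(2) 2] pq a b by simp
    next
      case 3
      then have "Phi a \<le> Phi (- t)" "Phi b \<le> Phi (- t)" by (auto intro: Phi_mono)
      then show ?thesis using Phi_tail[of t] t pq a b by simp
    qed
  qed
qed

subsection \<open>Isoperimetry on the line\<close>

lemma measure_normal_lessThan: "measure std_normal_distribution {..<a} = Phi a"
proof -
  have eq: "{..a} = {..<a} \<union> {a}" by auto
  have "Phi a = measure std_normal_distribution {..<a} + measure std_normal_distribution {a}"
    unfolding Phi_def eq by (subst N.finite_measure_Union) auto
  then show ?thesis by (simp add: normal_null_singleton)
qed

lemma measure_normal_greaterThan: "measure std_normal_distribution {a<..} = Phi (- a)"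
proof -
  have "{a<..} = UNIV - {..a}" by auto
  then show ?thesis
    unfolding Phi_minus unfolding Phi_def using N.prob_compl[of "{..a}"] by simp
qed

lemma measure_normal_greaterThanLessThan:
  assumes "c \<le> d"
  shows "measure std_normal_distribution {c<..<d} = Phi d - Phi c"
proof (cases "c = d")
  case False
  have eq: "{c<..<d} = {..<d} - {..c}" by auto
  have "measure std_normal_distribution {c<..<d} = measure std_normal_distribution {..<d} - measure std_normal_distribution {..c}"
    unfolding eq using assms False by (subst N.finite_measure_Diff) auto
  then show ?thesis by (simp add: measure_normal_lessThan Phi_def)
qed auto

lemma measure_normal_atLeastAtMost:
  assumes "x \<le> y"
  shows "measure std_normal_distribution {x..y} = Phi y - Phi x"
proof -
  have eq: "{x..y} = {..y} - {..<x}" by auto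
  have "measure std_normal_distribution {x..y} = measure std_normal_distribution {..y} - measure std_normal_distribution {..<x}"
    unfolding eq using assms by (subst N.finite_measure_Diff) auto
  then show ?thesis by (simp add: measure_normal_lessThan Phi_def)
qed

text \<open>The ratio between the measures of the enlargement and of the set is smallest for half-lines;
  being linear in \<open>D\<close>, the estimate can be summed over the components of an enlargement.\<close>

lemma open_interval_enlargement:
  assumes C: "open C" "connected C" and r: "r > 0"
    and D: "D \<in> sets borel" "\<And>x. x \<in> D \<Longrightarrow> ball x r \<subseteq> C"
    and a: "measure std_normal_distribution D \<le> Phi a"
  shows "Phi (a + r) * measure std_normal_distribution D \<le> measure std_normal_distribution C * Phi a"
proof (cases "measure std_normal_distribution D = 0 \<or> C = UNIV")
  case True
  then show ?thesis
  proof
    assume "C = UNIV"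
    then show ?thesis
      using mult_mono[OF Phi_le_1[of "a + r"] a] Phi_nonneg N.prob_space by simp
  qed (simp add: Phi_nonneg)
next
  case False
  then have "measure std_normal_distribution D > 0" and U: "C \<noteq> UNIV"
    by (auto simp: zero_less_measure_iff)
  then obtain b where b: "Phi b = measure std_normal_distribution D"
    using Phi_surj[of "measure std_normal_distribution D"] a Phi_less_1[of a] by auto
  have ba: "b \<le> a" using a unfolding b[symmetric] Phi_le_iff .
  have "D \<noteq> {}" using False by auto
  then obtain x0 where x0: "x0 \<in> D" by blast
  have sub: "x - s \<in> C" "x + s \<in> C" if "x \<in> D" "0 \<le> s" "s < r" for x s
    using D(2)[OF that(1)] that by (auto simp: dist_real_def subset_iff)
  have le: "measure std_normal_distribution D \<le> measure std_normal_distribution K"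
    if "K \<in> sets borel" "D \<subseteq> K" for K
    using that by (intro N.finite_measure_mono) auto
  have lower: "c + r \<le> x" if "x \<in> D" "C \<subseteq> {c<..}" for x c
    using sub(1)[OF that(1), of "x - c"] sub(1)[OF that(1), of 0] that(2) r by force
  have upper: "x \<le> d - r" if "x \<in> D" "C \<subseteq> {..<d}" for x d
    using sub(2)[OF that(1), of "d - x"] sub(1)[OF that(1), of 0] that(2) r by force
  have "Phi (b + r) \<le> measure std_normal_distribution C"
  proof -
    have "\<exists>c d. C = {..<d} \<or> C = {c<..} \<or> C = {c<..<d}"
    proof -
      have "C \<noteq> {}" "interior C = C"
        using C(1) sub(1)[OF x0, of 0] r by (auto simp: interior_open)
      moreover have "\<exists>c d. C = {} \<or> C = UNIV \<or> C = {..<d} \<or> C = {..d} \<or> C = {c<..} \<or> C = {c..} \<or>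
          C = {c<..<d} \<or> C = {c<..d} \<or> C = {c..<d} \<or> C = {c..d}"
        using connectedD_interval[OF C(2)] by (intro interval_cases) blast
      ultimately show ?thesis using U
        by (elim exE disjE) auto
    qed
    then consider d where "C = {..<d}" | c where "C = {c<..}" | c d where "C = {c<..<d}" by blast
    then show ?thesis
    proof cases
      case 1
      then have "Phi b \<le> Phi (d - r)"
        unfolding b Phi_def[of "d - r"] using upper by (intro le) auto
      then show ?thesis using 1 by (simp add: measure_normal_lessThan Phi_le_iff)
    next
      case 2
      then have "Phi b \<le> Phi (- (c + r))"
        unfolding b measure_normal_atLeast[symmetric] using lower by (intro le) auto
      then show ?thesis using 2 by (simp add: measure_normal_greaterThan Phi_le_iff)
    next
      case 3
      define x where "x = c + r"
      define y where "y = d - r"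
      have Ccd: "C \<subseteq> {c<..}" "C \<subseteq> {..<d}" using 3 by auto
      have xy: "x \<le> x0" "x0 \<le> y" using lower[OF x0 Ccd(1)] upper[OF x0 Ccd(2)] by (auto simp: x_def y_def)
      have "Phi b \<le> Phi y - Phi x"
        unfolding b using xy upper[OF _ Ccd(2)] lower[OF _ Ccd(1)]
        by (subst measure_normal_atLeastAtMost[symmetric]) (auto intro!: le simp: x_def y_def)
      then have s: "Phi x + Phi (- y) \<le> Phi (- b)" by (simp add: Phi_minus)
      then have "Phi x \<le> Phi (- b)" "Phi (- y) \<le> Phi (- b)"
        using Phi_nonneg[of x] Phi_nonneg[of "- y"] by linarith+
      \<comment> \<open>For a bounded interval the complement consists of two half-lines of total
        measure at most \<open>Phi (- b)\<close>. Retracting each by \<open>r\<close> shrinks it at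
        least by the factor \<open>Phi (- b - r) / Phi (- b)\<close>, since smaller half-lines lose
        relatively more; so the two together do no worse than a single half-line.\<close>
      then have "x - r \<le> - b - r" "- y - r \<le> - b - r" by (auto simp: Phi_le_iff)
      from this[THEN Phi_ratio_antimono[rotated], of r]
      have "Phi (- b) * (Phi (x - r) + Phi (- y - r)) \<le> (Phi x + Phi (- y)) * Phi (- b - r)"
        using r by (simp add: algebra_simps)
      also have "\<dots> \<le> Phi (- b) * Phi (- b - r)"
        using s by (intro mult_right_mono) (auto simp: Phi_nonneg)
      finally have "Phi (x - r) + Phi (- y - r) \<le> Phi (- b - r)"
        using Phi_pos[of "- b"] by simp
      moreover have "Phi (- y - r) = 1 - Phi (y + r)" "Phi (- b - r) = 1 - Phi (b + r)"
        using Phi_minus[of "y + r"] Phi_minus[of "b + r"] by simp_all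
      moreover have "measure std_normal_distribution C = Phi (y + r) - Phi (x - r)"
        using xy r 3 by (simp add: measure_normal_greaterThanLessThan x_def y_def)
      ultimately show ?thesis by linarith
    qed
  qed
  then have "Phi (b + r) * Phi a \<le> measure std_normal_distribution C * Phi a"
    by (intro mult_right_mono Phi_nonneg)
  \<comment> \<open>As \<open>b \<le> a\<close>, the ratio \<open>Phi (b + r) / Phi b\<close>
    attained by \<open>D\<close> is at least the one for \<open>a\<close>.\<close>
  then show ?thesis using Phi_ratio_antimono[of r b a] ba r b by simp
qed

text \<open>A ball around a point of \<open>A\<close> is connected, so it stays inside the component
  of \<open>E\<close> containing that point. Each component therefore contains the enlargement of
  its own share of \<open>A\<close>, and the shares are all compared with the same half-line
  \<open>{..b}\<close> having the measure of \<open>A\<close>. There are only countably many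
  components, being disjoint and open.\<close>

theorem normal_isoperimetry:
  assumes A: "A \<in> sets borel" and r: "r > 0"
    and a: "Phi a \<le> measure std_normal_distribution A"
  shows "Phi (a + r) \<le> measure std_normal_distribution (\<Union>x\<in>A. ball x r)"
proof -
  define E where "E = (\<Union>x\<in>A. ball x r)"
  have "open E" by (auto simp: E_def)
  have [measurable]: "E \<in> sets borel" using \<open>open E\<close> by auto
  have AE: "A \<subseteq> E" using r by (auto simp: E_def)
  show ?thesis
  \<comment> \<open>Full measure is set apart because \<open>Phi b = 1\<close> has no solution
    \<open>b\<close>.\<close>
  proof (cases "measure std_normal_distribution A = 1")
    case True
    have "measure std_normal_distribution A \<le> measure std_normal_distribution E"
      using AE by (intro N.finite_measure_mono) auto
    then show ?thesis using True Phi_le_1[of "a + r"] unfolding E_def by linarith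
  next
    case False
    then have "measure std_normal_distribution A < 1"
      using N.prob_le_1[of A] by linarith
    then obtain b where b: "Phi b = measure std_normal_distribution A"
      using Phi_surj[of "measure std_normal_distribution A"] a Phi_pos[of a] by auto
    have ba: "a \<le> b" using a unfolding b[symmetric] Phi_le_iff .
    have op: "open C" "connected C" if "C \<in> components E" for C
      using that open_components[OF \<open>open E\<close>] in_components_connected by auto
    have disj: "disjoint (components E)"
      by (simp add: pairwise_disjoint_components disjoint_def components_nonoverlap)
    have cnt: "countable (components E)"
      using op(1) disj by (intro countable_disjoint_open_subsets) 
    have sum: "emeasure std_normal_distribution B = (\<integral>\<^sup>+C. emeasure std_normal_distribution (B \<inter> C) \<partial>count_space (components E))"
      if "B \<in> sets borel" "B \<subseteq> E" for B
    proof -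
      have "B = (\<Union>C\<in>components E. B \<inter> C)" using that(2) Union_components[of E] by blast
      then have "emeasure std_normal_distribution B = emeasure std_normal_distribution (\<Union>C\<in>components E. B \<inter> C)" by simp
      also have "\<dots> = (\<integral>\<^sup>+C. emeasure std_normal_distribution (B \<inter> C) \<partial>count_space (components E))"
        using cnt disj that(1) op(1)
        by (intro emeasure_UN_countable) (auto simp: disjoint_family_on_def disjoint_def)
      finally show ?thesis .
    qed
    have comp: "ennreal (Phi (b + r)) * emeasure std_normal_distribution (A \<inter> C)
       \<le> ennreal (Phi b) * emeasure std_normal_distribution (E \<inter> C)" if "C \<in> components E" for C
    proof -
      have CE: "E \<inter> C = C" using in_components_subset[OF that] by auto
      have "Phi (b + r) * measure std_normal_distribution (A \<inter> C) \<le> measure std_normal_distribution C * Phi b"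
      proof (rule open_interval_enlargement[OF op[OF that] r])
        show "A \<inter> C \<in> sets borel" using A op(1)[OF that] by auto
        show "measure std_normal_distribution (A \<inter> C) \<le> Phi b"
          unfolding b using A by (intro N.finite_measure_mono) auto
        fix x assume "x \<in> A \<inter> C"
        then show "ball x r \<subseteq> C"
          using r by (intro components_maximal[OF that]) (auto simp: E_def)
      qed
      then show ?thesis
        by (simp add: CE N.emeasure_eq_measure Phi_nonneg mult.commute flip: ennreal_mult)
    qed
    have "ennreal (Phi (b + r)) * emeasure std_normal_distribution A
       = (\<integral>\<^sup>+C. ennreal (Phi (b + r)) * emeasure std_normal_distribution (A \<inter> C) \<partial>count_space (components E))"
      using sum[OF A AE] by (simp add: nn_integral_cmult)
    also have "\<dots> \<le> (\<integral>\<^sup>+C. ennreal (Phi b) * emeasure std_normal_distribution (E \<inter> C) \<partial>count_space (components E))"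
      using comp by (intro nn_integral_mono) auto
    also have "\<dots> = ennreal (Phi b) * emeasure std_normal_distribution E"
      using sum[of E] by (simp add: nn_integral_cmult)
    finally have "Phi (b + r) * Phi b \<le> Phi b * measure std_normal_distribution E"
      by (simp add: N.emeasure_eq_measure Phi_nonneg b[symmetric] flip: ennreal_mult)
    then have "Phi (b + r) \<le> measure std_normal_distribution E"
      using Phi_pos[of b] by (simp add: mult.commute)
    moreover have "Phi (a + r) \<le> Phi (b + r)" using ba by (intro Phi_mono) simp
    ultimately show ?thesis by (simp add: E_def)
  qed
qed

subsection \<open>The Gaussian measure on a Euclidean space\<close>

text \<open>Formulated for every Euclidean space, so that growth estimates proved once also serve
  the line, where this is the standard normal distribution (\<open>gauss_real\<close>).\<close>

definition gauss :: "'a::euclidean_space measure" where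
  "gauss = density lborel
     (\<lambda>x. ennreal ((2 * pi) powr (- real DIM('a) / 2) * exp (- (norm x)\<^sup>2 / 2)))"

lemma sets_gauss [simp, measurable_cong]: "sets gauss = sets borel"
  and space_gauss [simp]: "space gauss = UNIV"
  by (simp_all add: gauss_def)

lemma gauss_density_prod:
  fixes x :: "'a::euclidean_space"
  shows "(2 * pi) powr (- real DIM('a) / 2) * exp (- (norm x)\<^sup>2 / 2) = (\<Prod>b\<in>Basis. \<phi> (x \<bullet> b))"
proof -
  have "(norm x)\<^sup>2 = (\<Sum>b\<in>Basis. (x \<bullet> b)\<^sup>2)"
    by (simp add: norm_eq_sqrt_inner euclidean_inner[of x x] power2_eq_square sum_nonneg)
  then have "exp (- (norm x)\<^sup>2 / 2) = (\<Prod>b\<in>Basis. exp (- (x \<bullet> b)\<^sup>2 / 2))"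
    by (simp add: exp_sum[symmetric] sum_negf sum_divide_distrib)
  moreover have "(2 * pi) powr (- real DIM('a) / 2) = (1 / sqrt (2 * pi)) ^ DIM('a)"
  proof -
    have "1 / sqrt (2 * pi) = (2 * pi) powr (- 1 / 2)"
      by (simp add: powr_half_sqrt[symmetric] powr_minus_divide)
    then have "(1 / sqrt (2 * pi)) ^ DIM('a) = ((2 * pi) powr (- 1 / 2)) powr real DIM('a)"
      by (simp add: powr_realpow)
    then show ?thesis by (simp add: powr_powr)
  qed
  ultimately show ?thesis
    by (simp add: phi_eq prod_dividef power_one_over divide_simps)
qed

interpretation G: prob_space "gauss :: 'a::euclidean_space measure"
proof
  have "emeasure (gauss :: 'a measure) UNIV = (\<integral>\<^sup>+x. (\<Prod>b\<in>Basis. ennreal (\<phi> ((x::'a) \<bullet> b))) \<partial>lborel)"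
    unfolding gauss_def gauss_density_prod
    by (subst emeasure_density) (auto simp: prod_ennreal)
  also have "\<dots> = (\<Prod>b\<in>(Basis::'a set). (\<integral>\<^sup>+x. ennreal (\<phi> x) \<partial>lborel))"
    by (rule nn_integral_lborel_prod) auto
  also have "(\<integral>\<^sup>+x. ennreal (\<phi> x) \<partial>lborel) = 1"
    using N.emeasure_space_1 by (simp add: emeasure_density)
  finally show "emeasure (gauss :: 'a measure) (space gauss) = 1" by simp
qed

lemma measure_gauss_UNIV [simp]: "measure gauss UNIV = 1"
  using G.prob_space by simp

interpretation GN: pair_prob_space "gauss :: 'a::euclidean_space measure" std_normal_distribution ..

section \<open>Exchange of one coordinate with an independent copy\<close>

lemma lborel_fiberwise:
  fixes T :: "'a::euclidean_space \<Rightarrow> 'b::euclidean_space \<Rightarrow> 'b"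
  assumes m: "(\<lambda>(z, s). (z, T z s)) \<in> borel_measurable borel"
    and T: "\<And>z. distr lborel borel (T z) = lborel" "\<And>z. T z \<in> borel_measurable borel"
  shows "distr lborel borel (\<lambda>(z, s). (z, T z s)) = lborel"
proof (rule measure_eqI)
  fix X :: "('a \<times> 'b) set"
  assume "X \<in> sets (distr lborel borel (\<lambda>(z, s). (z, T z s)))"
  then have X: "X \<in> sets borel" by simp
  then have X': "X \<in> sets (borel \<Otimes>\<^sub>M borel)" unfolding borel_prod .
  then have X'': "X \<in> sets (lborel \<Otimes>\<^sub>M lborel)" by (simp cong: sets_pair_measure_cong)
  have m': "(\<lambda>x. indicator X ((\<lambda>(z, s). (z, T z s)) x) :: ennreal) \<in> borel_measurable (lborel \<Otimes>\<^sub>M lborel)"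
    unfolding lborel_prod using m X by (auto intro!: measurable_compose[OF m])
  have "emeasure (distr lborel borel (\<lambda>(z, s). (z, T z s))) X
    = (\<integral>\<^sup>+x. indicator X x \<partial>distr lborel borel (\<lambda>(z, s). (z, T z s)))"
    using X by simp
  also have "\<dots> = (\<integral>\<^sup>+x. indicator X ((\<lambda>(z, s). (z, T z s)) x) \<partial>(lborel \<Otimes>\<^sub>M lborel))"
    using m X by (subst nn_integral_distr) (auto simp: lborel_prod)
  also have "\<dots> = (\<integral>\<^sup>+z. \<integral>\<^sup>+s. indicator X (z, T z s) \<partial>lborel \<partial>lborel)"
    using m' by (subst lborel.nn_integral_fst[symmetric]) auto
  also have "\<dots> = (\<integral>\<^sup>+z. \<integral>\<^sup>+s. indicator X (z, s) \<partial>lborel \<partial>lborel)"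
  proof (rule nn_integral_cong)
    fix z
    have "(\<lambda>s. indicator X (z, s) :: ennreal) \<in> borel_measurable borel"
      using X' by (intro borel_measurable_indicator') auto
    then have "(\<integral>\<^sup>+s. indicator X (z, s) \<partial>distr lborel borel (T z)) = (\<integral>\<^sup>+s. indicator X (z, T z s) \<partial>lborel)"
      using T(2) by (subst nn_integral_distr) auto
    then show "(\<integral>\<^sup>+s. indicator X (z, T z s) \<partial>lborel) = (\<integral>\<^sup>+s. indicator X (z, s) \<partial>lborel)"
      by (simp add: T(1))
  qed
  also have "\<dots> = (\<integral>\<^sup>+x. indicator X x \<partial>(lborel \<Otimes>\<^sub>M lborel))"
    using X'' by (subst lborel.nn_integral_fst[symmetric]) auto
  also have "\<dots> = emeasure lborel X" using X by (simp add: lborel_prod)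
  finally show "emeasure (distr lborel borel (\<lambda>(z, s). (z, T z s))) X = emeasure lborel X" .
qed simp

lemma lborel_prod_swap:
  "distr lborel borel (\<lambda>(z::'a::euclidean_space, s::'b::euclidean_space). (s, z)) = lborel"
proof -
  have "(lborel :: ('b \<times> 'a) measure) = lborel \<Otimes>\<^sub>M lborel" by (simp add: lborel_prod)
  also have "\<dots> = distr (lborel \<Otimes>\<^sub>M lborel) (lborel \<Otimes>\<^sub>M lborel) (\<lambda>(x, y). (y, x))"
    by (rule lborel_pair.distr_pair_swap)
  also have "\<dots> = distr lborel borel (\<lambda>(z, s). (s, z))"
    unfolding lborel_prod by (rule distr_cong) auto
  finally show ?thesis ..
qed


lemma continuous_on_borel_lborel:
  "continuous_on UNIV f \<Longrightarrow> f \<in> measurable lborel borel"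
  by (simp add: borel_measurable_continuous_onI)

lemma distr_lborel_comp:
  assumes "distr lborel borel f = lborel" "distr lborel borel g = lborel"
    and "f \<in> measurable lborel borel" "g \<in> measurable lborel borel"
  shows "distr lborel borel (f \<circ> g) = lborel"
proof -
  have "distr (distr lborel borel g) borel f = distr lborel borel (f \<circ> g)"
    using assms by (intro distr_distr) auto
  then show ?thesis using assms by simp
qed

text \<open>For a unit vector \<open>w\<close> the coordinate \<open>z \<bullet> w\<close> is
  overwritten by \<open>s\<close>. Fixing \<open>z\<close> parametrises the line through
  \<open>z\<close> in direction \<open>w\<close>; drawing \<open>s\<close> from the normal
  distribution renews one coordinate. Fubini on \<open>gauss1\<close> thus stands in for a splitting
  of the space into a line and its orthogonal hyperplane.\<close>

definition resample :: "'a::euclidean_space \<Rightarrow> 'a \<times> real \<Rightarrow> 'a" where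
  "resample w x = fst x + (snd x - fst x \<bullet> w) *\<^sub>R w"

text \<open>Keeping the overwritten coordinate as second component makes the map a linear isometry
  of the product space.\<close>

definition swap_coord :: "'a::euclidean_space \<Rightarrow> 'a \<times> real \<Rightarrow> 'a \<times> real" where
  "swap_coord w x = (resample w x, fst x \<bullet> w)"

lemma continuous_resample [continuous_intros]:
  "continuous_on A f \<Longrightarrow> continuous_on A (\<lambda>x. resample w (f x))"
  unfolding resample_def by (intro continuous_intros)

lemma continuous_swap_coord: "continuous_on UNIV (swap_coord w)"
  unfolding swap_coord_def[abs_def] by (intro continuous_intros)

text \<open>The exchange of \<open>z \<bullet> w\<close> and \<open>s\<close> is a product of three shears and a sign change, each of
  which preserves Lebesgue measure by Fubini.\<close>

lemma lborel_swap_coord: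
  fixes w :: "'a::euclidean_space"
  assumes w: "norm w = 1"
  shows "distr lborel borel (swap_coord w) = lborel"
proof -
  define A where "A = (\<lambda>(z::'a, s::real). (z, s - z \<bullet> w))"
  define B where "B = (\<lambda>(z::'a, s::real). (z + s *\<^sub>R w, s))"
  define C where "C = (\<lambda>(z::'a, s::real). (z, - s))"
  define W where "W = (\<lambda>(z::'a, s::real). (s, z))"
  define W' where "W' = (\<lambda>(s::real, z::'a). (z, s))"
  define B' where "B' = (\<lambda>(s::real, z::'a). (s, z + s *\<^sub>R w))"
  have cont: "continuous_on UNIV A" "continuous_on UNIV B" "continuous_on UNIV C" "continuous_on UNIV W"
    "continuous_on UNIV W'" "continuous_on UNIV B'"
    unfolding A_def B_def C_def W_def W'_def B'_def split_beta by (intro continuous_intros)+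
  note meas = cont[THEN continuous_on_borel_lborel]
  have A: "distr lborel borel A = lborel"
    unfolding A_def
  proof (rule lborel_fiberwise)
    show "distr lborel borel (\<lambda>s. s - z \<bullet> w) = lborel" for z
    proof -
      have "(\<lambda>s. s - z \<bullet> w) = (+) (- (z \<bullet> w))" by auto
      then show ?thesis using lborel_distr_plus[of "- (z \<bullet> w)"] by simp
    qed
  qed (use meas in \<open>auto simp: A_def\<close>)
  have C: "distr lborel borel C = lborel"
    unfolding C_def
  proof (rule lborel_fiberwise)
    show "distr lborel borel uminus = (lborel :: real measure)" by (rule lborel_distr_uminus)
  qed (use meas in \<open>auto simp: C_def\<close>)
  have B': "distr lborel borel B' = lborel"
    unfolding B'_def
  proof (rule lborel_fiberwise)
    show "distr lborel borel (\<lambda>z. z + s *\<^sub>R w) = lborel" for s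
    proof -
      have "(\<lambda>z. z + s *\<^sub>R w) = (+) (s *\<^sub>R w)" by auto
      then show ?thesis using lborel_distr_plus[of "s *\<^sub>R w"] by simp
    qed
  qed (use meas in \<open>auto simp: B'_def\<close>)
  have B: "distr lborel borel B = lborel"
  proof -
    \<comment> \<open>\<open>B\<close> moves the first component, whereas the Fubini argument is set
      up for maps moving the second; hence the conjugation by the exchange of factors.\<close>
    have "distr lborel borel (W' \<circ> (B' \<circ> W)) = lborel"
      using meas B' lborel_prod_swap[where 'a='a and 'b=real] lborel_prod_swap[where 'a=real and 'b='a]
      by (intro distr_lborel_comp measurable_comp[where N=borel]) (auto simp: W_def W'_def)
    moreover have "W' \<circ> (B' \<circ> W) = B" by (auto simp: W_def W'_def B_def B'_def)
    ultimately show ?thesis by simp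
  qed
  have "distr lborel borel (C \<circ> (A \<circ> (B \<circ> A))) = lborel"
    using meas A B C by (intro distr_lborel_comp measurable_comp[where N=borel]) auto
  moreover have "C \<circ> (A \<circ> (B \<circ> A)) = swap_coord w"
    using w by (intro ext) (simp add: A_def B_def C_def swap_coord_def resample_def split_beta
        inner_add_left norm_eq_1)
  ultimately show ?thesis by simp
qed

lemma gauss_prod_density:
  fixes x :: "'a::euclidean_space \<times> real"
  shows "gauss \<Otimes>\<^sub>M std_normal_distribution = density lborel
     (\<lambda>x::'a \<times> real. ennreal ((2 * pi) powr (- real DIM('a) / 2) / sqrt (2 * pi) * exp (- (norm x)\<^sup>2 / 2)))"
proof -
  have "gauss \<Otimes>\<^sub>M std_normal_distribution = density (lborel \<Otimes>\<^sub>M lborel)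
     (\<lambda>(z::'a, s). ennreal ((2 * pi) powr (- real DIM('a) / 2) * exp (- (norm z)\<^sup>2 / 2)) * ennreal (\<phi> s))"
    unfolding gauss_def
    by (rule pair_measure_density) (auto simp: prob_space_imp_sigma_finite[OF N.prob_space_axioms] lborel.sigma_finite_measure_axioms)
  also have "\<dots> = density lborel
     (\<lambda>x::'a \<times> real. ennreal ((2 * pi) powr (- real DIM('a) / 2) / sqrt (2 * pi) * exp (- (norm x)\<^sup>2 / 2)))"
    unfolding lborel_prod
    by (intro density_cong AE_I2)
       (auto simp: borel_prod[symmetric] split_beta norm_prod_def phi_eq add_divide_distrib exp_add[symmetric] simp flip: ennreal_mult intro!: arg_cong[where f=ennreal])
  finally show ?thesis .
qed

lemma norm_swap_coord:
  assumes "norm w = 1"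
  shows "norm (swap_coord w x) = norm x"
proof -
  have ww: "w \<bullet> w = 1" using assms by (simp add: norm_eq_1)
  have "(norm (swap_coord w x))\<^sup>2 = (norm x)\<^sup>2"
    unfolding swap_coord_def resample_def
    by (cases x) (simp add: power2_norm_eq_inner inner_prod_def ww algebra_simps inner_commute)
  then show ?thesis by (simp add: power2_eq_iff_nonneg)
qed

text \<open>The product density depends on the norm only, and the map preserves both the norm and
  Lebesgue measure. The first marginal then shows that resampling preserves \<open>gauss\<close>,
  and the second that \<open>z \<bullet> w\<close> is standard normal.\<close>

lemma gauss_swap_coord:
  fixes w :: "'a::euclidean_space"
  assumes w: "norm w = 1"
  shows "distr (gauss \<Otimes>\<^sub>M std_normal_distribution) borel (swap_coord w) = gauss \<Otimes>\<^sub>M std_normal_distribution"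
proof -
  let ?h = "\<lambda>x::'a \<times> real. ennreal ((2 * pi) powr (- real DIM('a) / 2) / sqrt (2 * pi) * exp (- (norm x)\<^sup>2 / 2))"
  have "density (distr lborel borel (swap_coord w)) ?h = distr (density lborel (\<lambda>x. ?h (swap_coord w x))) borel (swap_coord w)"
    by (rule density_distr) (auto intro: borel_measurable_continuous_onI continuous_swap_coord)
  then show ?thesis
    by (simp add: gauss_prod_density lborel_swap_coord norm_swap_coord w)
qed


abbreviation gauss1 :: "('a::euclidean_space \<times> real) measure" where
  "gauss1 \<equiv> gauss \<Otimes>\<^sub>M std_normal_distribution"

lemma sets_gauss1 [simp, measurable_cong]: "sets gauss1 = sets borel"
  by (simp only: gauss_prod_density sets_density sets_lborel)

lemma measurable_gauss1_continuous:
  "continuous_on UNIV f \<Longrightarrow> f \<in> measurable gauss1 borel"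
  by (subst measurable_cong_sets[OF sets_gauss1 refl]) (rule borel_measurable_continuous_onI)

lemma distr_gauss1_fst: "distr gauss1 borel fst = gauss"
proof -
  have "distr gauss1 borel fst = distr gauss1 gauss (fst :: 'a \<times> real \<Rightarrow> 'a)"
    by (rule distr_cong) simp_all
  then show ?thesis using N.distr_pair_fst[of gauss] by simp
qed

lemma distr_gauss1_snd: "distr (gauss1 :: ('a::euclidean_space \<times> real) measure) borel snd = std_normal_distribution"
proof -
  have "distr (gauss1 :: ('a \<times> real) measure) borel snd = distr gauss1 std_normal_distribution (snd :: 'a \<times> real \<Rightarrow> real)"
    by (rule distr_cong) simp_all
  also have "\<dots> = distr (std_normal_distribution \<Otimes>\<^sub>M (gauss :: 'a measure)) std_normal_distribution fst"
    by (subst GN.distr_pair_swap, subst distr_distr[OF measurable_snd]) (auto simp: comp_def split_beta)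
  also have "\<dots> = std_normal_distribution"
    by (rule G.distr_pair_fst)
  finally show ?thesis .
qed

lemma distr_gauss1_resample:
  assumes "norm w = 1"
  shows "distr gauss1 borel (resample w) = gauss"
proof -
  have "distr (distr gauss1 borel (swap_coord w)) borel fst = distr gauss1 borel (fst \<circ> swap_coord w)"
    by (rule distr_distr) (auto intro!: measurable_gauss1_continuous borel_measurable_continuous_onI continuous_swap_coord continuous_intros)
  then show ?thesis
    by (simp add: gauss_swap_coord assms distr_gauss1_fst comp_def swap_coord_def)
qed

lemma distr_gauss_inner:
  assumes "norm w = 1"
  shows "distr gauss borel (\<lambda>z. z \<bullet> w) = std_normal_distribution"
proof -
  have "distr (distr gauss1 borel (swap_coord w)) borel snd = distr gauss1 borel (snd \<circ> swap_coord w)"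
    by (rule distr_distr) (auto intro!: measurable_gauss1_continuous borel_measurable_continuous_onI continuous_swap_coord continuous_intros)
  moreover have "distr (distr gauss1 borel fst) borel (\<lambda>z. z \<bullet> w) = distr gauss1 borel ((\<lambda>z. z \<bullet> w) \<circ> fst)"
    by (rule distr_distr) (auto intro!: measurable_gauss1_continuous borel_measurable_continuous_onI continuous_intros)
  moreover have "snd \<circ> swap_coord w = (\<lambda>z. z \<bullet> w) \<circ> fst" by (auto simp: swap_coord_def)
  ultimately show ?thesis
    by (simp add: gauss_swap_coord assms distr_gauss1_fst distr_gauss1_snd)
qed

section \<open>Integrability under quadratic growth\<close>

lemma integrable_normal_square: "integrable std_normal_distribution (\<lambda>x. x\<^sup>2)"
  using integrable_std_normal_moment[of 2] by (subst integrable_density) auto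

lemma integrable_gauss_norm_square: "integrable gauss (\<lambda>z. (norm z)\<^sup>2)"
proof -
  have "integrable gauss (\<lambda>z. (z \<bullet> b)\<^sup>2)" if "b \<in> Basis" for b
  proof -
    have "integrable (distr gauss borel (\<lambda>z. z \<bullet> b)) (\<lambda>x. x\<^sup>2)"
      using that integrable_normal_square by (simp add: distr_gauss_inner)
    then show ?thesis by (subst (asm) integrable_distr_eq) auto
  qed
  then have "integrable gauss (\<lambda>z. \<Sum>b\<in>Basis. (z \<bullet> b)\<^sup>2)" by (intro Bochner_Integration.integrable_sum)
  then show ?thesis
    unfolding power2_norm_eq_inner by (subst euclidean_inner) (simp add: power2_eq_square)
qed

lemma integrable_gauss_quadratic:
  fixes f :: "'a::euclidean_space \<Rightarrow> real"
  assumes "f \<in> borel_measurable borel" "\<And>z. \<bar>f z\<bar> \<le> c * (1 + (norm z)\<^sup>2)"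
  shows "integrable gauss f"
proof (rule Bochner_Integration.integrable_bound)
  show "integrable gauss (\<lambda>z. c * (1 + (norm z)\<^sup>2))"
    using integrable_gauss_norm_square by (intro integrable_mult_right Bochner_Integration.integrable_add) auto
  show "AE x in gauss. norm (f x) \<le> norm (c * (1 + (norm x)\<^sup>2))"
    using assms(2) by (intro AE_I2) (smt (verit) real_norm_def)
qed (use assms in simp)

lemma integrable_gauss1_quadratic:
  fixes f :: "'a::euclidean_space \<times> real \<Rightarrow> real"
  assumes "f \<in> borel_measurable borel" "\<And>x. \<bar>f x\<bar> \<le> c * (1 + (norm x)\<^sup>2)"
  shows "integrable gauss1 f"
proof (rule Bochner_Integration.integrable_bound)
  have "integrable gauss1 (\<lambda>x::'a \<times> real. (norm (fst x))\<^sup>2)"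
  proof (subst integrable_distr_eq[symmetric, where f="\<lambda>z. (norm z)\<^sup>2" and N=borel])
    show "integrable (distr (gauss1 :: ('a \<times> real) measure) borel fst) (\<lambda>z. (norm z)\<^sup>2)"
      using integrable_gauss_norm_square by (simp add: distr_gauss1_fst)
  qed (auto intro!: measurable_gauss1_continuous borel_measurable_continuous_onI continuous_intros)
  moreover have "integrable gauss1 (\<lambda>x::'a \<times> real. (snd x)\<^sup>2)"
  proof (subst integrable_distr_eq[symmetric, where f="\<lambda>s. s\<^sup>2" and N=borel])
    show "integrable (distr (gauss1 :: ('a \<times> real) measure) borel snd) (\<lambda>s. s\<^sup>2)"
      using integrable_normal_square by (simp add: distr_gauss1_snd)
  qed (auto intro!: measurable_gauss1_continuous borel_measurable_continuous_onI continuous_intros)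
  ultimately have "integrable gauss1 (\<lambda>x::'a \<times> real. c * (1 + ((norm (fst x))\<^sup>2 + (snd x)\<^sup>2)))"
    by (intro integrable_mult_right Bochner_Integration.integrable_add) auto
  then show "integrable gauss1 (\<lambda>x::'a \<times> real. c * (1 + (norm x)\<^sup>2))"
    by (simp add: norm_prod_def)
  show "AE x in gauss1. norm (f x) \<le> norm (c * (1 + (norm x)\<^sup>2))"
    using assms(2) by (intro AE_I2) (smt (verit) real_norm_def)
qed (use assms in simp)

text \<open>The density is positive everywhere and nonempty open sets are not Lebesgue null. This
  turns an equality of integrals into an identity at every point.\<close>

lemma gauss1_continuous_zero:
  fixes f :: "'a::euclidean_space \<times> real \<Rightarrow> real"
  assumes c: "continuous_on UNIV f" and nn: "\<And>x. f x \<ge> 0"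
    and i: "integrable gauss1 f" "(\<integral>x. f x \<partial>gauss1) \<le> 0"
  shows "f x = 0"
proof -
  have "(\<integral>x. f x \<partial>gauss1) = 0" using i nn by (simp add: order_antisym)
  then have "AE x in gauss1. f x = 0"
    using i nn by (subst (asm) integral_nonneg_eq_0_iff_AE) auto
  then have "AE x in lborel. f x = 0"
    unfolding gauss_prod_density by (subst (asm) AE_density) (auto simp: zero_less_mult_iff)
  moreover have o: "open {x. f x \<noteq> 0}"
    using c by (intro open_Collect_neq continuous_intros)
  ultimately have "{x. f x \<noteq> 0} \<in> null_sets lborel"
    by (subst AE_iff_null_sets) auto
  then have "negligible {x. f x \<noteq> 0}"
    by (simp add: negligible_iff_null_sets null_sets_completionI)
  with o have "{x. f x \<noteq> 0} = {}" using open_not_negligible by blast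
  then show ?thesis by (cases x) auto
qed

lemma gauss_real: "(gauss :: real measure) = std_normal_distribution"
  using gauss_density_prod[where 'a=real] by (simp add: gauss_def)

subsection \<open>Monotone rearrangement on the line\<close>

text \<open>The usual quantile function of the law of \<open>h\<close>, evaluated at the level
  \<open>Phi s\<close>: the nondecreasing rearrangement of \<open>h\<close> under the Gaussian
  measure. As \<open>0 < Phi s < 1\<close>, the infimum is over a nonempty set that is bounded
  below.\<close>

definition quantile :: "(real \<Rightarrow> real) \<Rightarrow> real \<Rightarrow> real" where
  "quantile h s = Inf {c. Phi s \<le> measure std_normal_distribution {x. h x \<le> c}}"

context
  fixes h :: "real \<Rightarrow> real"
  assumes h: "h \<in> borel_measurable borel"
begin

lemma real_distribution_normal_distr: "real_distribution (distr std_normal_distribution borel h)"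
  using h by (intro N.real_distribution_distr) simp

lemma cdf_normal_distr:
  "cdf (distr std_normal_distribution borel h) c = measure std_normal_distribution {x. h x \<le> c}"
  using h by (simp add: cdf_def measure_distr vimage_def)

text \<open>Right continuity of the distribution function makes the infimum a minimum. All
  properties of \<open>quantile\<close> are derived from this equivalence.\<close>

lemma quantile_le_iff: "quantile h s \<le> c \<longleftrightarrow> Phi s \<le> measure std_normal_distribution {x. h x \<le> c}"
proof -
  interpret D: real_distribution "distr std_normal_distribution borel h"
    by (rule real_distribution_normal_distr)
  let ?F = "cdf (distr std_normal_distribution borel h)"
  define S where "S = {c. Phi s \<le> ?F c}"
  have q: "quantile h s = Inf S" by (simp add: quantile_def S_def cdf_normal_distr)
  have "\<forall>\<^sub>F c in at_top. ?F c > Phi s"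
    using D.cdf_lim_at_top_prob Phi_less_1 by (rule order_tendstoD)
  then obtain u where "?F u > Phi s" by (metis eventually_at_top_linorder order_refl)
  then have "u \<in> S" by (simp add: S_def)
  have "\<forall>\<^sub>F c in at_bot. ?F c < Phi s"
    using D.cdf_lim_at_bot Phi_pos by (rule order_tendstoD)
  then obtain l where l: "?F l < Phi s" by (metis eventually_at_bot_linorder order_refl)
  have bdd: "bdd_below S"
  proof (rule bdd_belowI)
    fix c assume "c \<in> S"
    then have "?F l < ?F c" using l by (simp add: S_def)
    then show "l \<le> c" using D.cdf_nondecreasing[of c l] by linarith
  qed
  have "S \<noteq> {}" using \<open>u \<in> S\<close> by blast
  have gt: "c \<in> S" if "Inf S < c" for c
  proof -
    have "\<exists>c'\<in>S. c' < c" using that cInf_less_iff[OF \<open>S \<noteq> {}\<close> bdd] by simp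
    then obtain c' where "c' \<in> S" "c' < c" by blast
    then have "Phi s \<le> ?F c'" "?F c' \<le> ?F c" by (auto simp: S_def intro: D.cdf_nondecreasing)
    then show ?thesis unfolding S_def by (blast intro: order_trans)
  qed
  have "Phi s \<le> ?F (Inf S)"
  proof (rule tendsto_lowerbound)
    show "(?F \<longlongrightarrow> ?F (Inf S)) (at_right (Inf S))"
      using D.cdf_is_right_cont by (simp add: continuous_within)
    show "\<forall>\<^sub>F c in at_right (Inf S). Phi s \<le> ?F c"
      using gt by (auto simp: S_def eventually_at_right_field intro: exI[of _ "Inf S + 1"])
  qed simp
  then have "Inf S \<in> S" by (simp add: S_def)
  then have "Inf S \<le> c \<longleftrightarrow> c \<in> S"
    using cInf_lower[OF _ bdd] gt by (metis order_le_less)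
  then show ?thesis by (simp add: q S_def cdf_normal_distr)
qed

lemma mono_quantile: "mono (quantile h)"
proof (rule monoI)
  fix s t :: real assume "s \<le> t"
  then show "quantile h s \<le> quantile h t"
    using quantile_le_iff[of t "quantile h t"] Phi_mono[of s t] by (simp add: quantile_le_iff)
qed

lemma borel_measurable_quantile [measurable]: "quantile h \<in> borel_measurable borel"
  by (rule borel_measurable_mono[OF mono_quantile])

text \<open>The sublevel set of the rearrangement at \<open>c\<close> is the lower half-line with
  the measure \<open>?p\<close> of the sublevel set of \<open>h\<close>; it degenerates to the empty
  set or the whole line when \<open>?p\<close> is 0 or 1, values that \<open>Phi\<close>
  omits.\<close>

lemma distr_quantile:
  "distr std_normal_distribution borel (quantile h) = distr std_normal_distribution borel h"
proof (rule cdf_unique)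
  show "real_distribution (distr std_normal_distribution borel (quantile h))"
    by (intro N.real_distribution_distr) simp
  have "measure std_normal_distribution {s. quantile h s \<le> c} = measure std_normal_distribution {x. h x \<le> c}" for c
  proof -
    let ?p = "measure std_normal_distribution {x. h x \<le> c}"
    consider "?p \<le> 0" | "?p \<ge> 1" | "0 < ?p" "?p < 1" by linarith
    then show ?thesis
    proof cases
      case 1
      then have "{s. Phi s \<le> ?p} = {}" by (auto simp: not_le intro: le_less_trans[OF _ Phi_pos])
      then show ?thesis using 1 measure_nonneg[of std_normal_distribution "{x. h x \<le> c}"]
        by (simp add: quantile_le_iff del: measure_nonneg)
    next
      case 2
      then have "{s. Phi s \<le> ?p} = UNIV" using Phi_le_1 order_trans by fastforce
      then show ?thesis using 2 N.prob_le_1[of "{x. h x \<le> c}"] N.prob_space by (simp add: quantile_le_iff)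
    next
      case 3
      then obtain b where "Phi b = ?p" using Phi_surj by blast
      then have "{s. Phi s \<le> ?p} = {..b}" by (simp add: Phi_le_iff atMost_def flip: \<open>Phi b = ?p\<close>)
      then show ?thesis using \<open>Phi b = ?p\<close> by (simp add: quantile_le_iff Phi_def)
    qed
  qed
  then show "cdf (distr std_normal_distribution borel (quantile h)) = cdf (distr std_normal_distribution borel h)"
    by (intro ext) (simp add: cdf_normal_distr, simp add: cdf_def measure_distr vimage_def)
qed (rule real_distribution_normal_distr)

end

text \<open>Here \<open>h\<close> and \<open>h'\<close> stand for the restrictions of one
  1-Lipschitz function to two parallel lines at distance \<open>\<bar>a\<bar>\<close>. Comparing
  different lines is what makes the rearranged function Lipschitz in every direction, and not only
  along each line. The sublevel set of \<open>h'\<close> contains an enlargement of that of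
  \<open>h\<close>, whose measure is bounded below by isoperimetry.\<close>

lemma quantile_diff_le:
  assumes [measurable]: "h \<in> borel_measurable borel" "h' \<in> borel_measurable borel"
    and hh': "\<And>x x'. h' x' \<le> h x + sqrt (a\<^sup>2 + (x - x')\<^sup>2)"
  shows "quantile h' s' \<le> quantile h s + sqrt (a\<^sup>2 + (s - s')\<^sup>2)"
proof -
  let ?c = "quantile h s" and ?\<rho> = "sqrt (a\<^sup>2 + (s - s')\<^sup>2)"
  let ?A = "{x. h x \<le> ?c}"
  have A: "Phi s \<le> measure std_normal_distribution ?A"
    using quantile_le_iff[OF assms(1)] by blast
  have "Phi s' \<le> measure std_normal_distribution {x. h' x \<le> ?c + ?\<rho>}"
  proof (cases "s' \<le> s")
    case True
    \<comment> \<open>Moving down the line calls for no enlargement: opposite points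
      \<open>x = x'\<close> are compared, at cost \<open>\<bar>a\<bar>\<close>.\<close>
    have "Phi s' \<le> Phi s" using True by (rule Phi_mono)
    also note A
    also have "measure std_normal_distribution ?A \<le> measure std_normal_distribution {x. h' x \<le> ?c + ?\<rho>}"
    proof (rule N.finite_measure_mono)
      have "\<bar>a\<bar> \<le> ?\<rho>" using real_sqrt_le_mono[of "a\<^sup>2" "a\<^sup>2 + (s - s')\<^sup>2"] by simp
      moreover have "h' x \<le> h x + \<bar>a\<bar>" for x using hh'[of x x] by simp
      ultimately have "h' x \<le> h x + ?\<rho>" for x by (meson add_left_mono order_trans)
      then show "?A \<subseteq> {x. h' x \<le> ?c + ?\<rho>}" by (smt (verit, best) Collect_mono)
    qed simp
    finally show ?thesis .
  next
    case False
    have "Phi (s + (s' - s)) \<le> measure std_normal_distribution (\<Union>x\<in>?A. ball x (s' - s))"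
      using False A by (intro normal_isoperimetry) auto
    also have "\<dots> \<le> measure std_normal_distribution {x. h' x \<le> ?c + ?\<rho>}"
    proof (rule N.finite_measure_mono)
      show "(\<Union>x\<in>?A. ball x (s' - s)) \<subseteq> {x. h' x \<le> ?c + ?\<rho>}"
      proof safe
        fix x x' assume "h x \<le> ?c" "x' \<in> ball x (s' - s)"
        then have "\<bar>x - x'\<bar> \<le> \<bar>s - s'\<bar>" by (auto simp: dist_real_def)
        then have "(x - x')\<^sup>2 \<le> (s - s')\<^sup>2" by (simp add: abs_le_square_iff)
        then have "sqrt (a\<^sup>2 + (x - x')\<^sup>2) \<le> ?\<rho>" by (intro real_sqrt_le_mono) simp
        then show "h' x' \<le> ?c + ?\<rho>" using hh'[of x' x] \<open>h x \<le> ?c\<close> by linarith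
      qed
    qed simp
    finally show ?thesis by simp
  qed
  then show ?thesis by (simp add: quantile_le_iff)
qed

lemma lipschitz_quantile:
  assumes lip: "1-lipschitz_on UNIV h"
  shows "1-lipschitz_on UNIV (quantile h)"
proof (rule lipschitz_onI)
  have [measurable]: "h \<in> borel_measurable borel"
    using lipschitz_on_continuous_on[OF lip] by (rule borel_measurable_continuous_onI)
  have "h x' \<le> h x + sqrt (0\<^sup>2 + (x - x')\<^sup>2)" for x x'
    using lipschitz_onD[OF lip, of x x'] by (simp add: dist_real_def)
  from quantile_diff_le[OF _ _ this]
  have *: "quantile h s' \<le> quantile h s + \<bar>s - s'\<bar>" for s s' by simp
  show "dist (quantile h s) (quantile h s') \<le> 1 * dist s s'" for s s'
    using *[of s s'] *[of s' s] by (auto simp: dist_real_def)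
qed simp

text \<open>Letting \<open>s\<close> tend to plus or minus infinity shows that \<open>h > q\<close>,
  and \<open>h < d\<close> for each \<open>d < q\<close>, hold on null sets only. By continuity
  these sets are open, hence empty.\<close>

lemma constant_quantile:
  assumes c: "continuous_on UNIV h" and q: "\<And>s. quantile h s = q"
  shows "h x = q"
proof -
  have m [measurable]: "h \<in> borel_measurable borel"
    using c by (rule borel_measurable_continuous_onI)
  have null: "U = {}" if "open U" "measure std_normal_distribution U = 0" for U
  proof -
    have "U \<in> null_sets std_normal_distribution"
      using that by (simp add: null_setsI N.emeasure_eq_measure)
    then have "AE x in lborel. x \<notin> U"
      using that by (subst (asm) null_sets_density_iff) (auto elim!: eventually_mono simp: phi_pos[THEN less_imp_neq, symmetric])
    then have "U \<in> null_sets lborel" using that by (subst (asm) AE_iff_null_sets[symmetric]) auto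
    then have "negligible U" by (simp add: negligible_iff_null_sets null_sets_completionI)
    then show ?thesis using that open_not_negligible by blast
  qed
  have lim: "p \<ge> 1" if "\<And>s. Phi s \<le> p" for p
    by (rule tendsto_upperbound[OF Phi_at_top]) (use that in auto)
  have "measure std_normal_distribution {x. h x \<le> q} \<ge> 1"
    using quantile_le_iff[OF m] q by (intro lim) auto
  moreover have "measure std_normal_distribution {x. h x > q} = 1 - measure std_normal_distribution {x. h x \<le> q}"
    using N.prob_compl[of "{x. h x \<le> q}"] by (simp add: set_diff_eq not_le)
  ultimately have "measure std_normal_distribution {x. h x > q} \<le> 0" by simp
  then have "{x. h x > q} = {}"
    using c by (intro null open_Collect_less continuous_intros) (auto simp: measure_le_0_iff)
  moreover have "h x \<ge> d" if "d < q" for d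
  proof -
    have "measure std_normal_distribution {x. h x \<le> d} < Phi s" for s
      using quantile_le_iff[OF m, of s d] q[of s] that by simp
    then have "measure std_normal_distribution {x. h x \<le> d} \<le> 0"
      by (intro tendsto_lowerbound[OF Phi_at_bot] always_eventually allI less_imp_le) auto
    moreover have "measure std_normal_distribution {x. h x < d} \<le> measure std_normal_distribution {x. h x \<le> d}"
      by (intro N.finite_measure_mono) auto
    ultimately have "{x. h x < d} = {}"
      using c by (intro null open_Collect_less continuous_intros) (auto simp: measure_le_0_iff)
    then show ?thesis by (simp add: not_less set_eq_iff)
  qed
  ultimately show ?thesis using dense_le[of q "h x"] by (auto simp: set_eq_iff not_less intro: order_antisym)
qed

subsection \<open>Rearrangement in one direction\<close>

definition rearrange :: "('a::euclidean_space \<Rightarrow> real) \<Rightarrow> 'a \<Rightarrow> 'a \<Rightarrow> real" where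
  "rearrange F w z = quantile (\<lambda>s. F (resample w (z, s))) (z \<bullet> w)"

lemma lipschitz_borel:
  fixes F :: "'a::euclidean_space \<Rightarrow> real"
  shows "1-lipschitz_on UNIV F \<Longrightarrow> F \<in> borel_measurable borel"
  by (intro borel_measurable_continuous_onI lipschitz_on_continuous_on)

lemma lipschitz_growth:
  fixes F :: "'a::euclidean_space \<Rightarrow> real"
  assumes "1-lipschitz_on UNIV F"
  shows "\<bar>F z\<bar> \<le> \<bar>F 0\<bar> + norm z"
  using lipschitz_onD[OF assms, of z 0] by (simp add: dist_real_def)

lemma le_1_plus_square: "x \<le> 1 + x\<^sup>2" for x :: real
  using zero_le_power2[of "x - 1/2"] by (simp add: power2_eq_square algebra_simps)

lemma integrable_gauss_lipschitz_comp:
  fixes F :: "'a::euclidean_space \<Rightarrow> real"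
  assumes F: "1-lipschitz_on UNIV F" and k: "continuous_on UNIV k" and A: "\<And>x. \<bar>k x\<bar> \<le> A * (1 + \<bar>x\<bar>)"
  shows "integrable gauss (\<lambda>z. k (F z))"
proof (rule integrable_gauss_quadratic)
  have "A * (1 + \<bar>0\<bar>) \<ge> 0" using A[of 0] by linarith
  then have A0: "A \<ge> 0" by simp
  show "\<bar>k (F z)\<bar> \<le> (A * (2 + \<bar>F 0\<bar>)) * (1 + (norm z)\<^sup>2)" for z
  proof -
    have "1 + \<bar>F z\<bar> \<le> (1 + \<bar>F 0\<bar>) * 1 + 1 * norm z" using lipschitz_growth[OF F, of z] by simp
    also have "\<dots> \<le> (1 + \<bar>F 0\<bar>) * (1 + (norm z)\<^sup>2) + 1 * (1 + (norm z)\<^sup>2)"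
      using le_1_plus_square[of "norm z"] by (intro add_mono mult_left_mono) auto
    also have "\<dots> = (2 + \<bar>F 0\<bar>) * (1 + (norm z)\<^sup>2)" by (simp add: algebra_simps)
    finally have "A * (1 + \<bar>F z\<bar>) \<le> A * ((2 + \<bar>F 0\<bar>) * (1 + (norm z)\<^sup>2))"
      using A0 by (rule mult_left_mono)
    then show ?thesis using A[of "F z"] by (simp add: mult.assoc)
  qed
  show "(\<lambda>z. k (F z)) \<in> borel_measurable borel"
    using k lipschitz_borel[OF F] by (rule borel_measurable_continuous_on)
qed

text \<open>The points \<open>z\<close> and \<open>x\<close> are kept separate so that the bound
  also covers a second factor from the independent coordinate. It depends on \<open>F\<close>
  through \<open>F 0\<close> only, which makes it uniform over a class with bounded
  \<open>F 0\<close>.\<close>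

lemma lipschitz_times_inner_bound:
  fixes F :: "'a::euclidean_space \<Rightarrow> real"
  assumes F: "1-lipschitz_on UNIV F"
  shows "\<bar>F z * (x \<bullet> u)\<bar> \<le> ((\<bar>F 0\<bar> + 1) * norm u) * ((1 + norm z) * norm x)"
proof -
  have "\<bar>F z\<bar> \<le> \<bar>F 0\<bar> * 1 + 1 * norm z" using lipschitz_growth[OF F, of z] by simp
  also have "\<dots> \<le> \<bar>F 0\<bar> * (1 + norm z) + 1 * (1 + norm z)"
    by (intro add_mono mult_left_mono) auto
  finally have "\<bar>F z\<bar> * \<bar>x \<bullet> u\<bar> \<le> (\<bar>F 0\<bar> * (1 + norm z) + 1 * (1 + norm z)) * (norm x * norm u)"
    by (intro mult_mono Cauchy_Schwarz_ineq2) auto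
  then show ?thesis by (simp add: abs_mult algebra_simps)
qed

lemma quad_bound: "(1 + a) * b \<le> 2 * (1 + c\<^sup>2)" if "0 \<le> a" "0 \<le> b" "a \<le> c" "b \<le> c" for a b c :: real
proof -
  have "(1 + a) * b \<le> (1 + c) * c" using that by (intro mult_mono) auto
  also have "\<dots> \<le> 2 * (1 + c\<^sup>2)" using le_1_plus_square[of c] by (simp add: power2_eq_square algebra_simps)
  finally show ?thesis .
qed

lemma integrable_gauss_lipschitz_inner:
  fixes F :: "'a::euclidean_space \<Rightarrow> real"
  assumes F: "1-lipschitz_on UNIV F"
  shows "integrable gauss (\<lambda>z. F z * (z \<bullet> u))"
proof (rule integrable_gauss_quadratic)
  show "(\<lambda>z. F z * (z \<bullet> u)) \<in> borel_measurable borel"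
    using lipschitz_borel[OF F] by measurable
  show "\<bar>F z * (z \<bullet> u)\<bar> \<le> ((\<bar>F 0\<bar> + 1) * norm u * 2) * (1 + (norm z)\<^sup>2)" for z
  proof -
    have "((\<bar>F 0\<bar> + 1) * norm u) * ((1 + norm z) * norm z) \<le> ((\<bar>F 0\<bar> + 1) * norm u) * (2 * (1 + (norm z)\<^sup>2))"
      by (intro mult_left_mono quad_bound) auto
    then show ?thesis using lipschitz_times_inner_bound[OF F, of z z u] by (simp add: mult.assoc)
  qed
qed

context
  fixes w :: "'a::euclidean_space"
  assumes w: "norm w = 1"
begin

lemma inner_self_1: "w \<bullet> w = 1" using w by (simp add: norm_eq_1)

lemma resample_inner [simp]: "resample w (z, s) \<bullet> w = s"
  by (simp add: resample_def inner_add_left inner_self_1)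

lemma resample_resample [simp]: "resample w (resample w (z, s), t) = resample w (z, t)"
  by (simp add: resample_def inner_add_left inner_self_1 algebra_simps flip: scaleR_add_left)

lemma resample_self [simp]: "resample w (z, z \<bullet> w) = z"
  by (simp add: resample_def)

lemma norm_add_orthogonal:
  assumes "u \<bullet> w = 0"
  shows "(norm (u + c *\<^sub>R w))\<^sup>2 = (norm u)\<^sup>2 + c\<^sup>2"
proof -
  have "w \<bullet> u = 0" using assms by (simp only: inner_commute)
  then show ?thesis
    unfolding power2_norm_eq_inner
    using assms by (simp add: inner_add_left inner_add_right inner_self_1 power2_eq_square)
qed

text \<open>Pythagoras: \<open>resample w (z - z', 0)\<close> is the projection of
  \<open>z - z'\<close> to the hyperplane orthogonal to \<open>w\<close>, so its norm is the
  distance of the two lines.\<close>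

lemma dist_resample:
  "dist (resample w (z, s)) (resample w (z', s')) = sqrt ((norm (resample w (z - z', 0)))\<^sup>2 + (s - s')\<^sup>2)"
proof -
  have "resample w (z, s) - resample w (z', s') = resample w (z - z', 0) + (s - s') *\<^sub>R w"
    by (simp add: resample_def algebra_simps inner_diff_left)
  moreover have "resample w (z - z', 0) \<bullet> w = 0" by simp
  ultimately have "(norm (resample w (z, s) - resample w (z', s')))\<^sup>2
      = (norm (resample w (z - z', 0)))\<^sup>2 + (s - s')\<^sup>2"
    using norm_add_orthogonal[of "resample w (z - z', 0)" "s - s'"] by presburger
  then show ?thesis unfolding dist_norm using real_sqrt_unique[OF _ norm_ge_zero] by metis
qed

lemma rearrange_resample:
  "rearrange F w (resample w (z, s)) = quantile (\<lambda>t. F (resample w (z, t))) s"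
  by (simp add: rearrange_def)

context
  fixes F :: "'a \<Rightarrow> real"
  assumes F: "1-lipschitz_on UNIV F"
begin

lemma lipschitz_line: "1-lipschitz_on UNIV (\<lambda>s. F (resample w (z, s)))"
proof (rule lipschitz_onI)
  show "dist (F (resample w (z, s))) (F (resample w (z, t))) \<le> 1 * dist s t" for s t
    using lipschitz_onD[OF F, of "resample w (z, s)" "resample w (z, t)"]
    by (simp add: dist_resample dist_real_def) (simp add: resample_def)
qed simp

lemma lipschitz_rearrange: "1-lipschitz_on UNIV (rearrange F w)"
proof (rule lipschitz_onI)
  have *: "rearrange F w z' \<le> rearrange F w z + dist z z'" for z z'
  proof -
    let ?a = "norm (resample w (z - z', 0))"
    have "F (resample w (z', x')) \<le> F (resample w (z, x)) + sqrt (?a\<^sup>2 + (x - x')\<^sup>2)" for x x'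
      using lipschitz_onD[OF F, of "resample w (z, x)" "resample w (z', x')"]
      unfolding dist_resample by (simp add: dist_real_def)
    from quantile_diff_le[OF lipschitz_borel[OF lipschitz_line] lipschitz_borel[OF lipschitz_line] this]
    have "rearrange F w z' \<le> rearrange F w z + sqrt (?a\<^sup>2 + (z \<bullet> w - z' \<bullet> w)\<^sup>2)"
      unfolding rearrange_def .
    also have "sqrt (?a\<^sup>2 + (z \<bullet> w - z' \<bullet> w)\<^sup>2) = dist z z'"
      using dist_resample[of z "z \<bullet> w" z' "z' \<bullet> w"] by simp
    finally show ?thesis .
  qed
  show "dist (rearrange F w z) (rearrange F w z') \<le> 1 * dist z z'" for z z'
    using *[of z z'] *[of z' z] by (auto simp: dist_real_def[of "rearrange _ _ _"] dist_commute)
qed simp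

lemma gauss_integral_resample:
  fixes H :: "'a \<Rightarrow> real"
  assumes [measurable]: "H \<in> borel_measurable borel" and i: "integrable gauss H"
  shows "(\<integral>z. H z \<partial>gauss) = (\<integral>z. (\<integral>s. H (resample w (z, s)) \<partial>std_normal_distribution) \<partial>gauss)"
proof -
  have m: "resample w \<in> measurable gauss1 borel"
    by (intro measurable_gauss1_continuous continuous_intros)
  have i1: "integrable gauss1 (\<lambda>x. H (resample w x))"
  proof (subst integrable_distr_eq[symmetric, where g="resample w" and N=borel])
    show "integrable (distr gauss1 borel (resample w)) H"
      using i by (simp add: distr_gauss1_resample[OF w])
  qed (use m in auto)
  have "(\<integral>z. H z \<partial>gauss) = (\<integral>z. H z \<partial>distr gauss1 borel (resample w))"
    by (simp add: distr_gauss1_resample[OF w])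
  also have "\<dots> = (\<integral>x. H (resample w x) \<partial>gauss1)"
    using m by (subst integral_distr) auto
  also have "\<dots> = (\<integral>z. (\<integral>s. H (resample w (z, s)) \<partial>std_normal_distribution) \<partial>gauss)"
    using GN.integral_fst'[OF i1] by simp
  finally show ?thesis .
qed

text \<open>On each line the function and its rearrangement have the same law, while
  \<open>q\<close> is constant there. With \<open>q = 1\<close> this preserves the law; with
  \<open>q z = z \<bullet> v\<close> for \<open>v\<close> orthogonal to \<open>w\<close> it
  preserves the moment along \<open>v\<close>.\<close>

lemma gauss_integral_rearrange:
  fixes k :: "real \<Rightarrow> real" and q :: "'a \<Rightarrow> real"
  assumes [measurable]: "k \<in> borel_measurable borel" "q \<in> borel_measurable borel"
    and q: "\<And>z s. q (resample w (z, s)) = q z"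
    and i: "integrable gauss (\<lambda>z. k (F z) * q z)" "integrable gauss (\<lambda>z. k (rearrange F w z) * q z)"
  shows "(\<integral>z. k (rearrange F w z) * q z \<partial>gauss) = (\<integral>z. k (F z) * q z \<partial>gauss)"
proof -
  note [measurable] = lipschitz_borel[OF F] lipschitz_borel[OF lipschitz_rearrange]
  have "(\<integral>z. k (rearrange F w z) * q z \<partial>gauss)
      = (\<integral>z. (\<integral>s. k (quantile (\<lambda>t. F (resample w (z, t))) s) \<partial>std_normal_distribution) * q z \<partial>gauss)"
    by (subst gauss_integral_resample) (auto simp: q i rearrange_resample)
  also have "\<dots> = (\<integral>z. (\<integral>s. k (F (resample w (z, s))) \<partial>std_normal_distribution) * q z \<partial>gauss)"
  proof (rule Bochner_Integration.integral_cong[OF refl])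
    fix z
    have m: "(\<lambda>t. F (resample w (z, t))) \<in> borel_measurable borel" by (rule lipschitz_borel[OF lipschitz_line])
    have "(\<integral>x. k x \<partial>distr std_normal_distribution borel (quantile (\<lambda>t. F (resample w (z, t)))))
        = (\<integral>x. k x \<partial>distr std_normal_distribution borel (\<lambda>t. F (resample w (z, t))))"
      by (simp only: distr_quantile[OF m])
    then show "(\<integral>s. k (quantile (\<lambda>t. F (resample w (z, t))) s) \<partial>std_normal_distribution) * q z
        = (\<integral>s. k (F (resample w (z, s))) \<partial>std_normal_distribution) * q z"
      using m borel_measurable_quantile[OF m] by (simp add: integral_distr)
  qed
  also have "\<dots> = (\<integral>z. k (F z) * q z \<partial>gauss)"
    by (subst (2) gauss_integral_resample) (auto simp: q i)
  finally show ?thesis .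
qed

text \<open>Exchanging the coordinate along \<open>w\<close> with an independent copy \<open>s\<close> and averaging turns the moment
  in direction \<open>w\<close> into half the integral of \<open>e\<close> below, which is nonnegative by monotonicity.\<close>

lemma rearrange_gain:
  assumes le: "(\<integral>z. rearrange F w z * (z \<bullet> w) \<partial>gauss) \<le> 0"
  shows "F (resample w (z, s)) = F z"
proof -
  define G where "G = rearrange F w"
  have G: "1-lipschitz_on UNIV G" unfolding G_def by (rule lipschitz_rearrange)
  have Gc: "continuous_on A G" for A using lipschitz_on_continuous_on[OF G] continuous_on_subset by blast
  define e where "e x = (G (fst x) - G (resample w x)) * (fst x \<bullet> w - snd x)" for x
  have cont: "continuous_on UNIV (\<lambda>x. G (fst x))" "continuous_on UNIV (\<lambda>x. G (resample w x))"
    by (intro continuous_on_compose2[OF Gc[of UNIV]] continuous_intros; simp)+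
  have bound: "\<bar>G (fst x) * (fst x \<bullet> w)\<bar> \<le> (\<bar>G 0\<bar> + 1) * 2 * (1 + (norm x)\<^sup>2)"
    "\<bar>G (fst x) * snd x\<bar> \<le> (\<bar>G 0\<bar> + 1) * 2 * (1 + (norm x)\<^sup>2)" for x :: "'a \<times> real"
  proof -
    have n: "norm (fst x) \<le> norm x" "norm (snd x) \<le> norm x"
      using norm_fst_le[of "fst x" "snd x"] norm_snd_le[of "snd x" "fst x"] by simp_all
    have "(\<bar>G 0\<bar> + 1) * ((1 + norm (fst x)) * norm (fst x)) \<le> (\<bar>G 0\<bar> + 1) * (2 * (1 + (norm x)\<^sup>2))"
      "(\<bar>G 0\<bar> + 1) * ((1 + norm (fst x)) * norm (snd x)) \<le> (\<bar>G 0\<bar> + 1) * (2 * (1 + (norm x)\<^sup>2))"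
      using n by (intro mult_left_mono quad_bound; simp)+
    then show "\<bar>G (fst x) * (fst x \<bullet> w)\<bar> \<le> (\<bar>G 0\<bar> + 1) * 2 * (1 + (norm x)\<^sup>2)"
      "\<bar>G (fst x) * snd x\<bar> \<le> (\<bar>G 0\<bar> + 1) * 2 * (1 + (norm x)\<^sup>2)"
      using lipschitz_times_inner_bound[OF G, of "fst x" "fst x" w]
        lipschitz_times_inner_bound[OF G, of "fst x" "snd x *\<^sub>R w" w] w
      by (simp_all add: mult.assoc inner_self_1 del: distrib_left_numeral distrib_right_numeral)
  qed
  have i1: "integrable gauss1 (\<lambda>x. G (fst x) * (fst x \<bullet> w))"
    using bound(1) cont by (intro integrable_gauss1_quadratic borel_measurable_continuous_onI continuous_intros) auto
  have i2: "integrable gauss1 (\<lambda>x. G (fst x) * snd x)"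
    using bound(2) cont by (intro integrable_gauss1_quadratic borel_measurable_continuous_onI continuous_intros) auto
  define d where "d x = G (fst x) * (fst x \<bullet> w) - G (fst x) * snd x" for x
  have di: "integrable gauss1 d" unfolding d_def using i1 i2 by (rule Bochner_Integration.integrable_diff)
  have dm: "d \<in> borel_measurable borel"
    unfolding d_def[abs_def] using cont by (intro borel_measurable_continuous_onI continuous_intros) auto
  have sm: "swap_coord w \<in> measurable gauss1 borel"
    by (intro measurable_gauss1_continuous continuous_swap_coord)
  have dsi: "integrable gauss1 (\<lambda>x. d (swap_coord w x))"
  proof (subst integrable_distr_eq[symmetric, where g="swap_coord w" and N=borel])
    show "integrable (distr gauss1 borel (swap_coord w)) d"
      using di by (simp add: gauss_swap_coord[OF w])
  qed (use dm sm in auto)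
  have ds: "(\<integral>x. d (swap_coord w x) \<partial>gauss1) = (\<integral>x. d x \<partial>gauss1)"
    using dm sm by (subst integral_distr[symmetric]) (auto simp: gauss_swap_coord[OF w])
  have e: "e x = d x + d (swap_coord w x)" for x
    by (simp add: e_def d_def swap_coord_def algebra_simps resample_def inner_add_left inner_self_1)
  have "(\<integral>x. G (fst x) * (fst x \<bullet> w) \<partial>gauss1) = (\<integral>z. G z * (z \<bullet> w) \<partial>gauss)"
    using GN.integral_fst'[OF i1] N.prob_space by simp
  \<comment> \<open>The second coordinate is independent of the first and has mean zero.\<close>
  moreover have "(\<integral>x. G (fst x) * snd x \<partial>gauss1) = 0"
    using GN.integral_fst'[OF i2] normal_expectation_uminus(1)[of "\<lambda>x. x"] by simp
  ultimately have "(\<integral>x. d x \<partial>gauss1) \<le> 0"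
    unfolding d_def using i1 i2 le by (simp add: G_def)
  then have "(\<integral>x. e x \<partial>gauss1) \<le> 0"
    unfolding e using di dsi ds by simp
  moreover have "integrable gauss1 e" unfolding e[abs_def] using di dsi by simp
  moreover have "continuous_on UNIV e"
    unfolding e_def[abs_def] using cont by (intro continuous_intros)
  moreover have "e x \<ge> 0" for x
  proof -
    obtain z s where x: "x = (z, s)" by (cases x)
    let ?q = "quantile (\<lambda>t. F (resample w (z, t)))"
    have "G z = ?q (z \<bullet> w)" "G (resample w x) = ?q s"
      by (simp_all add: G_def x rearrange_resample) (simp add: rearrange_def)
    moreover have "mono ?q" by (intro mono_quantile lipschitz_borel lipschitz_line)
    ultimately show ?thesis
      unfolding e_def x by (cases "s \<le> z \<bullet> w") (auto simp: mono_def intro: mult_nonneg_nonneg mult_nonpos_nonpos)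
  qed
  ultimately have e0: "e x = 0" for x using gauss1_continuous_zero[of e x] by blast
  let ?q = "quantile (\<lambda>t. F (resample w (z, t)))"
  \<comment> \<open>One factor of \<open>e\<close> vanishes: either the two rearranged values agree,
    or \<open>s\<close> equals \<open>z \<bullet> w\<close> and the claim is trivial.\<close>
  have "?q s = ?q (z \<bullet> w)" for s
    using e0[of "(z, s)"] by (auto simp: e_def G_def rearrange_resample) (auto simp: rearrange_def)
  then have "F (resample w (z, s)) = ?q (z \<bullet> w)" for s
    using constant_quantile[OF lipschitz_on_continuous_on[OF lipschitz_line]] by metis
  from this[of s] this[of "z \<bullet> w"] show ?thesis by simp
qed

end

end

subsection \<open>Extremal functions with a given law\<close>

lemma lipschitz_pointwise_limit:
  fixes G :: "'a::euclidean_space \<Rightarrow> real"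
  assumes "\<And>n. 1-lipschitz_on UNIV (F n)" "\<And>z. (\<lambda>n. F n z) \<longlonglongrightarrow> G z"
  shows "1-lipschitz_on UNIV G"
proof (rule lipschitz_onI)
  fix x y
  have "(\<lambda>n. dist (F n x) (F n y)) \<longlonglongrightarrow> dist (G x) (G y)"
    using assms(2) by (intro tendsto_dist)
  then show "dist (G x) (G y) \<le> 1 * dist x y"
    by (rule tendsto_upperbound) (use lipschitz_onD[OF assms(1)] in auto)
qed simp

text \<open>Arzela-Ascoli in pointwise form: convergence on a countable dense set spreads to all
  points by the common Lipschitz constant. Pointwise limits suffice, since integrals are passed to
  the limit by dominated convergence.\<close>

lemma lipschitz_convergent_subsequence:
  fixes F :: "nat \<Rightarrow> 'a::euclidean_space \<Rightarrow> real"
  assumes lip: "\<And>n. 1-lipschitz_on UNIV (F n)" and bnd: "\<And>n. \<bar>F n 0\<bar> \<le> C"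
  obtains r G where "strict_mono r" "1-lipschitz_on UNIV G" "\<And>z. (\<lambda>n. F (r n) z) \<longlonglongrightarrow> G z"
proof -
  obtain D :: "'a set" where D: "countable D" "\<And>X. open X \<Longrightarrow> X \<noteq> {} \<Longrightarrow> \<exists>d\<in>D. d \<in> X"
    using countable_dense_setE[where 'a='a] by blast
  have "D \<noteq> {}" using D(2)[of UNIV] by auto
  define d where "d = from_nat_into D"
  have rd: "range d = D" using D(1) \<open>D \<noteq> {}\<close> by (simp add: d_def)
  \<comment> \<open>Tychonoff for a countable product of intervals, in its sequential form, replaces
    the diagonal choice of subsequences.\<close>
  define K where "K = (\<Pi>\<^sub>E i\<in>(UNIV::nat set). {- (C + norm (d i))..C + norm (d i)})"
  have "compactin (product_topology (\<lambda>i. euclidean) UNIV) K"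
    unfolding K_def by (subst compactin_PiE) auto
  then have "seq_compact K"
    unfolding euclidean_product_topology by (simp add: compact_imp_seq_compact)
  moreover have "(\<lambda>i. F n (d i)) \<in> K" for n
    unfolding K_def
  proof (rule PiE_I)
    show "F n (d i) \<in> {- (C + norm (d i))..C + norm (d i)}" for i
      using lipschitz_growth[OF lip, of n "d i"] bnd[of n] by auto
  qed simp
  ultimately obtain l r where r: "strict_mono r" and l: "((\<lambda>n i. F n (d i)) \<circ> r) \<longlonglongrightarrow> l"
    unfolding seq_compact_def by metis
  have conv: "(\<lambda>n. F (r n) (d i)) \<longlonglongrightarrow> l i" for i
    using continuous_on_tendsto_compose[OF continuous_on_product_coordinates[of i] l] by (simp add: comp_def)
  have "Cauchy (\<lambda>n. F (r n) z)" for z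
  proof (rule metric_CauchyI)
    fix e :: real assume e: "e > 0"
    obtain i where i: "d i \<in> ball z (e / 3)"
      using D(2)[of "ball z (e/3)"] e rd by auto
    have "Cauchy (\<lambda>n. F (r n) (d i))" using conv by (intro convergent_Cauchy convergentI)
    then obtain N where N: "\<And>m n. m \<ge> N \<Longrightarrow> n \<ge> N \<Longrightarrow> dist (F (r m) (d i)) (F (r n) (d i)) < e / 3"
      using e metric_CauchyD[of _ "e / 3"] by fastforce
    show "\<exists>M. \<forall>m\<ge>M. \<forall>n\<ge>M. dist (F (r m) z) (F (r n) z) < e"
    proof (intro exI allI impI)
      fix m n assume "N \<le> m" "N \<le> n"
      then have "dist (F (r m) (d i)) (F (r n) (d i)) < e / 3" by (rule N)
      moreover have "dist (F k z) (F k (d i)) < e / 3" for k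
        using lipschitz_onD[OF lip, of z "d i" k] i by simp
      from this[of "r m"] this[of "r n"] have "dist (F (r m) z) (F (r m) (d i)) < e / 3"
        "dist (F (r n) z) (F (r n) (d i)) < e / 3" .
      ultimately show "dist (F (r m) z) (F (r n) z) < e"
        unfolding dist_real_def by linarith
    qed
  qed
  then have "convergent (\<lambda>n. F (r n) z)" for z by (rule Cauchy_convergent)
  then obtain G where G: "\<And>z. (\<lambda>n. F (r n) z) \<longlonglongrightarrow> G z" unfolding convergent_def by metis
  show thesis by (rule that[OF r lipschitz_pointwise_limit[OF lip G] G])
qed

text \<open>Equality of laws is tested on continuous functions only, so that it survives pointwise
  limits. Linear growth admits the identity, which gives the mean, and the absolute value, which
  bounds \<open>F 0\<close>.\<close>

definition equimeasurable :: "('a::euclidean_space \<Rightarrow> real) \<Rightarrow> ('a \<Rightarrow> real) \<Rightarrow> bool" where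
  "equimeasurable f F \<longleftrightarrow> 1-lipschitz_on UNIV F \<and>
     (\<forall>k A. continuous_on UNIV k \<longrightarrow> (\<forall>x. \<bar>k x\<bar> \<le> A * (1 + \<bar>x\<bar>)) \<longrightarrow> 
        (\<integral>z. k (F z) \<partial>gauss) = (\<integral>z. k (f z) \<partial>gauss))"

lemma equimeasurable_rearrange:
  assumes "equimeasurable f F" and w: "norm w = 1"
  shows "equimeasurable f (rearrange F w)"
proof -
  have F: "1-lipschitz_on UNIV F" using assms by (simp add: equimeasurable_def)
  have "(\<integral>z. k (rearrange F w z) \<partial>gauss) = (\<integral>z. k (F z) \<partial>gauss)"
    if k: "continuous_on UNIV k" "\<And>x. \<bar>k x\<bar> \<le> A * (1 + \<bar>x\<bar>)" for k A
    using gauss_integral_rearrange[OF w F, of k "\<lambda>_. 1"] k(1)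
      integrable_gauss_lipschitz_comp[OF F k] integrable_gauss_lipschitz_comp[OF lipschitz_rearrange[OF w F] k]
    by (simp add: borel_measurable_continuous_onI)
  then show ?thesis
    using assms lipschitz_rearrange[OF w F] unfolding equimeasurable_def by metis
qed

text \<open>Average \<open>\<bar>F 0\<bar> \<le> \<bar>F z\<bar> + norm z\<close> and use that
  \<open>F\<close> and \<open>f\<close> have the same absolute first moment. The bound depends on
  \<open>f\<close> alone, which supplies compactness and the dominating functions.\<close>

lemma equimeasurable_bound:
  fixes F :: "'a::euclidean_space \<Rightarrow> real"
  assumes f: "equimeasurable f F"
  shows "\<bar>F 0\<bar> \<le> (\<integral>z. \<bar>f z\<bar> \<partial>gauss) + (\<integral>z. norm z \<partial>(gauss :: 'a measure))"
proof -
  have F: "1-lipschitz_on UNIV F" using f by (simp add: equimeasurable_def)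
  have i: "integrable gauss (\<lambda>z. \<bar>F z\<bar>)"
    by (rule integrable_gauss_lipschitz_comp[OF F, where k=abs and A=1]) (auto intro: continuous_intros)
  have n: "integrable gauss (norm :: 'a \<Rightarrow> real)"
    by (rule integrable_gauss_quadratic[where c=1]) (use le_1_plus_square in auto)
  have "\<bar>F 0\<bar> = (\<integral>z. \<bar>F 0\<bar> \<partial>(gauss :: 'a measure))" by simp
  also have "\<dots> \<le> (\<integral>z. \<bar>F z\<bar> + norm z \<partial>gauss)"
  proof (rule integral_mono)
    show "\<bar>F 0\<bar> \<le> \<bar>F z\<bar> + norm z" for z
      using lipschitz_onD[OF F, of z 0] by (simp add: dist_real_def)
  qed (use i n in auto)
  also have "\<dots> = (\<integral>z. \<bar>F z\<bar> \<partial>gauss) + (\<integral>z. norm z \<partial>(gauss :: 'a measure))"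
    using i n by simp
  also have "(\<integral>z. \<bar>F z\<bar> \<partial>gauss) = (\<integral>z. \<bar>f z\<bar> \<partial>gauss)"
    using f unfolding equimeasurable_def by (elim conjE allE[of _ abs] allE[of _ 1]) (auto intro: continuous_intros)
  finally show ?thesis .
qed

lemma equimeasurable_limit:
  fixes F :: "nat \<Rightarrow> 'a::euclidean_space \<Rightarrow> real"
  assumes F: "\<And>n. equimeasurable f (F n)" and lim: "\<And>z. (\<lambda>n. F n z) \<longlonglongrightarrow> G z"
  shows "equimeasurable f G"
proof -
  define C where "C = (\<integral>z. \<bar>f z\<bar> \<partial>gauss) + (\<integral>z. norm z \<partial>(gauss :: 'a measure))"
  have C: "\<bar>F n 0\<bar> \<le> C" for n unfolding C_def by (rule equimeasurable_bound[OF F])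
  have lip: "1-lipschitz_on UNIV (F n)" for n using F by (simp add: equimeasurable_def)
  have G: "1-lipschitz_on UNIV G" by (rule lipschitz_pointwise_limit[OF lip lim])
  have "(\<integral>z. k (G z) \<partial>gauss) = (\<integral>z. k (f z) \<partial>gauss)"
    if k: "continuous_on UNIV k" and A: "\<And>x. \<bar>k x\<bar> \<le> A * (1 + \<bar>x\<bar>)" for k A
  proof (rule LIMSEQ_unique)
    have "A * (1 + \<bar>0\<bar>) \<ge> 0" using A[of 0] by linarith
    then have A0: "A \<ge> 0" by simp
    have km: "k \<in> borel_measurable borel" using k by (rule borel_measurable_continuous_onI)
    show "(\<lambda>n. \<integral>z. k (F n z) \<partial>gauss) \<longlonglongrightarrow> (\<integral>z. k (G z) \<partial>gauss)"
    proof (rule integral_dominated_convergence)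
      show "integrable gauss (\<lambda>z::'a. A * (1 + C + norm z))"
        using integrable_gauss_quadratic[of norm 1] le_1_plus_square by auto
      show "AE z in gauss. (\<lambda>n. k (F n z)) \<longlonglongrightarrow> k (G z)"
        using continuous_on_tendsto_compose[OF k lim] by simp
      show "AE z in gauss. norm (k (F n z)) \<le> A * (1 + C + norm z)" for n
      proof (rule AE_I2)
        fix z
        have "A * (1 + \<bar>F n z\<bar>) \<le> A * (1 + C + norm z)"
          using lipschitz_growth[OF lip, of n z] C[of n] A0 by (intro mult_left_mono) auto
        then show "norm (k (F n z)) \<le> A * (1 + C + norm z)" using A[of "F n z"] by simp
      qed
    qed (use km lipschitz_borel[OF lip] lipschitz_borel[OF G] in \<open>auto intro: measurable_compose\<close>)
    have "(\<integral>z. k (F n z) \<partial>gauss) = (\<integral>z. k (f z) \<partial>gauss)" for n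
      using F[of n] k A unfolding equimeasurable_def by blast
    then show "(\<lambda>n. \<integral>z. k (F n z) \<partial>gauss) \<longlonglongrightarrow> (\<integral>z. k (f z) \<partial>gauss)" by simp
  qed
  then show ?thesis using G unfolding equimeasurable_def by blast
qed

lemma inner_moment_limit:
  fixes F :: "nat \<Rightarrow> 'a::euclidean_space \<Rightarrow> real"
  assumes F: "\<And>n. 1-lipschitz_on UNIV (F n)" "\<And>n. \<bar>F n 0\<bar> \<le> C"
    and lim: "\<And>z. (\<lambda>n. F n z) \<longlonglongrightarrow> G z" and v: "\<And>n. norm (v n) = 1" "v \<longlonglongrightarrow> u"
  shows "(\<lambda>n. \<integral>z. F n z * (z \<bullet> v n) \<partial>gauss) \<longlonglongrightarrow> (\<integral>z. G z * (z \<bullet> u) \<partial>gauss)"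
proof (rule integral_dominated_convergence)
  have [measurable]: "F n \<in> borel_measurable borel" for n by (rule lipschitz_borel[OF F(1)])
  have [measurable]: "G \<in> borel_measurable borel" 
    by (rule lipschitz_borel[OF lipschitz_pointwise_limit[OF F(1) lim]])
  show "(\<lambda>z. F n z * (z \<bullet> v n)) \<in> borel_measurable gauss" for n by measurable
  show "(\<lambda>z. G z * (z \<bullet> u)) \<in> borel_measurable gauss" by measurable
  show "integrable gauss (\<lambda>z::'a. (C + 1) * (2 * (1 + (norm z)\<^sup>2)))"
    using integrable_gauss_norm_square by (intro integrable_mult_right Bochner_Integration.integrable_add) auto
  show "AE z in gauss. (\<lambda>n. F n z * (z \<bullet> v n)) \<longlonglongrightarrow> G z * (z \<bullet> u)"
    using lim v(2) by (intro AE_I2 tendsto_mult tendsto_inner tendsto_const)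
  show "AE z in gauss. norm (F n z * (z \<bullet> v n)) \<le> (C + 1) * (2 * (1 + (norm z)\<^sup>2))" for n
  proof (rule AE_I2)
    fix z
    have "\<bar>F n z * (z \<bullet> v n)\<bar> \<le> (\<bar>F n 0\<bar> + 1) * ((1 + norm z) * norm z)"
      using lipschitz_times_inner_bound[OF F(1), of n z z "v n"] v by simp
    also have "\<dots> \<le> (C + 1) * (2 * (1 + (norm z)\<^sup>2))"
      using F(2)[of n] by (intro mult_mono quad_bound) auto
    finally show "norm (F n z * (z \<bullet> v n)) \<le> (C + 1) * (2 * (1 + (norm z)\<^sup>2))" by simp
  qed
qed

text \<open>Along a maximising sequence the functions converge pointwise on a subsequence, and the
  unit vectors on a further one, by compactness of the sphere. The uniform bound on
  \<open>F 0\<close> makes the moments bounded and continuous under this convergence.\<close>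

lemma maximal_inner_moment:
  fixes f :: "'a::euclidean_space \<Rightarrow> real"
  assumes f: "1-lipschitz_on UNIV f"
  obtains F v where "equimeasurable f F" "norm v = 1"
    "\<And>F' v'. equimeasurable f F' \<Longrightarrow> norm v' = 1 \<Longrightarrow>
       (\<integral>z. F' z * (z \<bullet> v') \<partial>gauss) \<le> (\<integral>z. F z * (z \<bullet> v) \<partial>gauss)"
proof -
  define C where "C = (\<integral>z. \<bar>f z\<bar> \<partial>gauss) + (\<integral>z. norm z \<partial>(gauss :: 'a measure))"
  define J where "J F v = (\<integral>z. F z * (z \<bullet> v) \<partial>gauss)" for F and v :: 'a
  define V where "V = {J F v |F v. equimeasurable f F \<and> norm v = 1}"
  define B where "B = (C + 1) * (2 * (1 + (\<integral>z. (norm z)\<^sup>2 \<partial>(gauss :: 'a measure))))"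
  have C: "\<bar>F 0\<bar> \<le> C" if "equimeasurable f F" for F
    unfolding C_def by (rule equimeasurable_bound[OF that])
  have ff: "equimeasurable f f" using f by (simp add: equimeasurable_def)
  have "V \<noteq> {}"
    using ff norm_Basis[OF SOME_Basis] unfolding V_def by blast
  have bdd: "bdd_above V"
  proof (rule bdd_aboveI)
    fix x assume "x \<in> V"
    then obtain F v where Fv: "equimeasurable f F" "norm v = 1" "x = J F v" by (auto simp: V_def)
    have lip: "1-lipschitz_on UNIV F" using Fv by (simp add: equimeasurable_def)
    have "J F v \<le> (\<integral>z. (C + 1) * (2 * (1 + (norm z)\<^sup>2)) \<partial>(gauss :: 'a measure))"
      unfolding J_def
    proof (rule integral_mono)
      show "integrable gauss (\<lambda>z. F z * (z \<bullet> v))" by (rule integrable_gauss_lipschitz_inner[OF lip])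
      show "integrable gauss (\<lambda>z::'a. (C + 1) * (2 * (1 + (norm z)\<^sup>2)))"
        using integrable_gauss_norm_square by (intro integrable_mult_right Bochner_Integration.integrable_add) auto
      fix z
      have "\<bar>F z * (z \<bullet> v)\<bar> \<le> (\<bar>F 0\<bar> + 1) * ((1 + norm z) * norm z)"
        using lipschitz_times_inner_bound[OF lip, of z z v] Fv by simp
      also have "\<dots> \<le> (C + 1) * (2 * (1 + (norm z)\<^sup>2))"
        using C[OF Fv(1)] by (intro mult_mono quad_bound) auto
      finally show "F z * (z \<bullet> v) \<le> (C + 1) * (2 * (1 + (norm z)\<^sup>2))" by simp
    qed
    then show "x \<le> B" using integrable_gauss_norm_square[where 'a='a]
      by (simp add: B_def Fv)
  qed
  have "\<exists>F v. equimeasurable f F \<and> norm v = 1 \<and> J F v > Sup V - inverse (real (Suc n))" for n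
  proof -
    have "Sup V - inverse (real (Suc n)) < Sup V" by simp
    then obtain x where "x \<in> V" "Sup V - inverse (real (Suc n)) < x"
      using less_cSup_iff[OF \<open>V \<noteq> {}\<close> bdd] by blast
    then show ?thesis by (auto simp: V_def)
  qed
  then obtain F v where Fv: "\<And>n. equimeasurable f (F n)" "\<And>n. norm (v n) = 1"
    "\<And>n. J (F n) (v n) > Sup V - inverse (real (Suc n))" by metis
  have lip: "1-lipschitz_on UNIV (F n)" for n using Fv(1) by (simp add: equimeasurable_def)
  obtain r G where r: "strict_mono r" and G: "\<And>z. (\<lambda>n. F (r n) z) \<longlonglongrightarrow> G z"
    using lipschitz_convergent_subsequence[of F C] lip C Fv(1) by metis
  have "seq_compact (sphere (0::'a) 1)" by (rule compact_imp_seq_compact) simp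
  moreover have "\<forall>n. v (r n) \<in> sphere 0 1" using Fv(2) by simp
  ultimately obtain u r' where u: "u \<in> sphere 0 1" "strict_mono r'" "((\<lambda>n. v (r n)) \<circ> r') \<longlonglongrightarrow> u"
    by (rule seq_compactE)
  define R where "R = r \<circ> r'"
  have R: "strict_mono R" unfolding R_def using r u(2) by (rule strict_mono_o)
  have GR: "(\<lambda>n. F (R n) z) \<longlonglongrightarrow> G z" for z
    using LIMSEQ_subseq_LIMSEQ[OF G u(2)] by (simp add: R_def comp_def)
  have eq: "equimeasurable f G" by (rule equimeasurable_limit[OF _ GR]) (rule Fv(1))
  have "(\<lambda>n. J (F (R n)) (v (R n))) \<longlonglongrightarrow> J G u"
    unfolding J_def
    using lip C[OF Fv(1)] GR Fv(2) u(3) by (intro inner_moment_limit) (auto simp: R_def comp_def)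
  moreover have "(\<lambda>n. Sup V - inverse (real (Suc (R n)))) \<longlonglongrightarrow> Sup V - 0"
    using LIMSEQ_subseq_LIMSEQ[OF LIMSEQ_inverse_real_of_nat R] by (intro tendsto_intros) (simp add: comp_def)
  ultimately have "Sup V - 0 \<le> J G u"
    using Fv(3) by (intro LIMSEQ_le[where X="\<lambda>n. Sup V - inverse (real (Suc (R n)))"]) (auto intro: less_imp_le)
  moreover have "J F' v' \<le> Sup V" if "equimeasurable f F'" "norm v' = 1" for F' v'
    using that by (intro cSup_upper bdd) (auto simp: V_def)
  ultimately show thesis
    using eq u(1) by (intro that[of G u]) (force simp: J_def)+
qed

subsection \<open>Reduction to the line\<close>

text \<open>The function \<open>z \<bullet> v\<close> is constant on lines parallel to
  \<open>w\<close>, so rearranging leaves the moment \<open>S\<close> along \<open>v\<close>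
  unchanged. A nonzero moment \<open>\<delta>\<close> along \<open>w\<close> would contradict
  maximality, and \<open>rearrange_gain\<close> settles the case
  \<open>\<delta> = 0\<close>.\<close>

lemma maximal_inner_moment_constant:
  fixes F :: "'a::euclidean_space \<Rightarrow> real"
  assumes F: "equimeasurable f F" and v: "norm v = 1"
    and max: "\<And>F' v'. equimeasurable f F' \<Longrightarrow> norm v' = 1 \<Longrightarrow>
       (\<integral>z. F' z * (z \<bullet> v') \<partial>gauss) \<le> (\<integral>z. F z * (z \<bullet> v) \<partial>gauss)"
    and w: "norm w = 1" "w \<bullet> v = 0"
  shows "F (resample w (z, s)) = F z"
proof (rule rearrange_gain)
  show "norm w = 1" by fact
  show lip: "1-lipschitz_on UNIV F" using F by (simp add: equimeasurable_def)
  define G where "G = rearrange F w"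
  have G: "equimeasurable f G" unfolding G_def by (rule equimeasurable_rearrange[OF F w(1)])
  have lipG: "1-lipschitz_on UNIV G" using G by (simp add: equimeasurable_def)
  define S where "S = (\<integral>z. F z * (z \<bullet> v) \<partial>gauss)"
  define \<delta> where "\<delta> = (\<integral>z. G z * (z \<bullet> w) \<partial>gauss)"
  have "(\<integral>z. F z * (z \<bullet> (- v)) \<partial>gauss) \<le> S"
    unfolding S_def using v by (intro max F) simp
  then have S0: "S \<ge> 0" by (simp add: S_def)
  have "(\<integral>z. G z * (z \<bullet> v) \<partial>gauss) = S"
    unfolding G_def S_def
  proof (rule gauss_integral_rearrange[where k="\<lambda>x. x", OF w(1) lip])
    show "resample w (z, s) \<bullet> v = z \<bullet> v" for z s
      by (simp add: resample_def inner_add_left w)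
    show "integrable gauss (\<lambda>z. F z * (z \<bullet> v))" by (rule integrable_gauss_lipschitz_inner[OF lip])
    show "integrable gauss (\<lambda>z. rearrange F w z * (z \<bullet> v))"
      using integrable_gauss_lipschitz_inner[OF lipG] by (simp add: G_def)
  qed auto
  have "\<delta> = 0"
  proof (rule ccontr)
    assume \<delta>: "\<delta> \<noteq> 0"
    define N where "N = sqrt (S\<^sup>2 + \<delta>\<^sup>2)"
    \<comment> \<open>The unit vector in the direction of the moments \<open>(S, \<delta>)\<close>,
      which is the best choice in the plane of \<open>v\<close> and \<open>w\<close>; it gives the
      moment \<open>N\<close>.\<close>
    define v' where "v' = (S / N) *\<^sub>R v + (\<delta> / N) *\<^sub>R w"
    have NN: "N\<^sup>2 = S\<^sup>2 + \<delta>\<^sup>2" by (simp add: N_def)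
    have N: "N > 0" unfolding N_def using \<delta> by (intro real_sqrt_gt_zero add_nonneg_pos) auto
    have vv: "v \<bullet> v = 1" "w \<bullet> w = 1" "v \<bullet> w = 0"
      using v w by (simp_all add: norm_eq_1 inner_commute[of v w])
    have "v' \<bullet> v' = (S\<^sup>2 + \<delta>\<^sup>2) / N\<^sup>2"
      by (simp add: v'_def inner_add_left inner_add_right vv w power2_eq_square add_divide_distrib)
    also have "\<dots> = 1" using N unfolding NN[symmetric] by simp
    finally have "norm v' = 1" by (simp add: norm_eq_1)
    have "(\<integral>z. G z * (z \<bullet> v') \<partial>gauss)
        = (\<integral>z. (S / N) * (G z * (z \<bullet> v)) + (\<delta> / N) * (G z * (z \<bullet> w)) \<partial>gauss)"
      by (rule Bochner_Integration.integral_cong) (simp_all add: v'_def inner_add_right algebra_simps)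
    also have "\<dots> = (S / N) * S + (\<delta> / N) * \<delta>"
      using integrable_gauss_lipschitz_inner[OF lipG] \<open>(\<integral>z. G z * (z \<bullet> v) \<partial>gauss) = S\<close>
      by (simp add: \<delta>_def)
    also have "\<dots> = N" using N NN by (simp add: field_simps power2_eq_square)
    finally have "N \<le> S"
      using max[OF G \<open>norm v' = 1\<close>] by (simp add: S_def)
    then have "N\<^sup>2 \<le> S\<^sup>2" using N by (intro power_mono) auto
    then show False using NN \<delta> by simp
  qed
  then show "(\<integral>z. rearrange F w z * (z \<bullet> w) \<partial>gauss) \<le> 0"
    by (simp add: \<delta>_def G_def)
qed

theorem gauss_lipschitz_monotone_rearrangement:
  fixes f :: "'a::euclidean_space \<Rightarrow> real"
  assumes f: "1-lipschitz_on UNIV f"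
  obtains T :: "real \<Rightarrow> real" where "mono T" "1-lipschitz_on UNIV T"
    "\<And>k A. continuous_on UNIV k \<Longrightarrow> (\<And>x. \<bar>k x\<bar> \<le> A * (1 + \<bar>x\<bar>)) \<Longrightarrow>
       (\<integral>s. k (T s) \<partial>std_normal_distribution) = (\<integral>z. k (f z) \<partial>gauss)"
proof -
  obtain F v where F: "equimeasurable f F" and v: "norm v = 1"
    and max: "\<And>F' v'. equimeasurable f F' \<Longrightarrow> norm v' = 1 \<Longrightarrow>
       (\<integral>z. F' z * (z \<bullet> v') \<partial>gauss) \<le> (\<integral>z. F z * (z \<bullet> v) \<partial>gauss)"
    using maximal_inner_moment[OF f] by metis
  have lip: "1-lipschitz_on UNIV F" using F by (simp add: equimeasurable_def)
  define T where "T s = F (s *\<^sub>R v)" for s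
  have FT: "F z = T (z \<bullet> v)" for z
  proof (cases "z = (z \<bullet> v) *\<^sub>R v")
    case False
    define y where "y = z - (z \<bullet> v) *\<^sub>R v"
    \<comment> \<open>Along the direction of the component of \<open>z\<close> orthogonal to
      \<open>v\<close>, setting the coordinate to \<open>0\<close> moves \<open>z\<close> onto the
      axis spanned by \<open>v\<close> in a single step.\<close>
    define w where "w = y /\<^sub>R norm y"
    have y: "norm y > 0" using False by (simp add: y_def)
    have yv: "y \<bullet> v = 0" using v by (simp add: y_def inner_diff_left norm_eq_1)
    have w: "norm w = 1" "w \<bullet> v = 0" using y yv by (auto simp: w_def)
    have "z = y + (z \<bullet> v) *\<^sub>R v" by (simp add: y_def)
    then have "z \<bullet> y = y \<bullet> y" using yv by (metis add.right_neutral inner_add_left inner_commute inner_scaleR_left mult_zero_right)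
    then have "z \<bullet> w = norm y" using y by (simp add: w_def dot_square_norm power2_eq_square)
    then have "resample w (z, 0) = z - y" using y by (simp add: resample_def w_def)
    then show ?thesis
      using maximal_inner_moment_constant[OF F v max w, of z 0] by (simp add: T_def y_def)
  qed (simp add: T_def)
  have T: "1-lipschitz_on UNIV T"
  proof (rule lipschitz_onI)
    show "dist (T s) (T t) \<le> 1 * dist s t" for s t
      using lipschitz_onD[OF lip, of "s *\<^sub>R v" "t *\<^sub>R v"] v
      by (simp add: T_def dist_real_def[of s] dist_norm[of "s *\<^sub>R v"] flip: scaleR_diff_left)
  qed simp
  show thesis
  \<comment> \<open>Monotonicity of \<open>T\<close> itself has not been established; one more
    rearrangement on the line provides it without changing the law or the Lipschitz
    constant.\<close>
  proof (rule that[of "quantile T"])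
    show "mono (quantile T)" by (rule mono_quantile[OF lipschitz_borel[OF T]])
    show "1-lipschitz_on UNIV (quantile T)" by (rule lipschitz_quantile[OF T])
    fix k :: "real \<Rightarrow> real" and A
    assume k: "continuous_on UNIV k" "\<And>x. \<bar>k x\<bar> \<le> A * (1 + \<bar>x\<bar>)"
    have [measurable]: "k \<in> borel_measurable borel" using k(1) by (rule borel_measurable_continuous_onI)
    note [measurable] = lipschitz_borel[OF T] borel_measurable_quantile[OF lipschitz_borel[OF T]]
    have "(\<integral>s. k (quantile T s) \<partial>std_normal_distribution) = (\<integral>x. k x \<partial>distr std_normal_distribution borel (quantile T))"
      by (subst integral_distr) auto
    also have "\<dots> = (\<integral>x. k x \<partial>distr std_normal_distribution borel T)"
      by (simp only: distr_quantile[OF lipschitz_borel[OF T]])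
    also have "\<dots> = (\<integral>s. k (T s) \<partial>distr gauss borel (\<lambda>z. z \<bullet> v))"
      unfolding distr_gauss_inner[OF v] by (subst integral_distr) auto
    also have "\<dots> = (\<integral>z. k (F z) \<partial>gauss)"
      by (subst integral_distr) (auto simp: FT)
    also have "\<dots> = (\<integral>z. k (f z) \<partial>gauss)"
      using F k unfolding equimeasurable_def by blast
    finally show "(\<integral>s. k (quantile T s) \<partial>std_normal_distribution) = (\<integral>z. k (f z) \<partial>gauss)" .
  qed
qed

theorem gauss_lipschitz_deviation:
  fixes f :: "'a::euclidean_space \<Rightarrow> real"
  assumes f: "1-lipschitz_on UNIV f" and M: "M = (\<integral>z. f z \<partial>gauss)" and t: "t > 0"
  shows "measure gauss {z. \<bar>f z - M\<bar> \<ge> t} \<le> exp (- t\<^sup>2 / 2)"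
proof -
  obtain T :: "real \<Rightarrow> real" where T: "mono T" "1-lipschitz_on UNIV T"
    and Tk: "\<And>k A. continuous_on UNIV k \<Longrightarrow> (\<And>x. \<bar>k x\<bar> \<le> A * (1 + \<bar>x\<bar>)) \<Longrightarrow>
       (\<integral>s. k (T s) \<partial>std_normal_distribution) = (\<integral>z. k (f z) \<partial>gauss)"
    using gauss_lipschitz_monotone_rearrangement[OF f] by metis
  note [measurable] = lipschitz_borel[OF f] lipschitz_borel[OF T(2)]
  have TM: "(\<integral>s. T s \<partial>std_normal_distribution) = M"
    using Tk[of "\<lambda>x. x" 1] by (simp add: M)
  have Ti: "integrable std_normal_distribution T"
    using integrable_gauss_lipschitz_comp[OF T(2), of "\<lambda>x. x" 1] by (simp add: gauss_real)
  have bound: "measure gauss {z. \<bar>f z - M\<bar> \<ge> t} \<le> exp (- (t - \<delta>)\<^sup>2 / 2)" if \<delta>: "0 < \<delta>" "\<delta> < t" for \<delta>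
  proof -
    \<comment> \<open>A continuous ramp between the indicators of
      \<open>\<bar>x - M\<bar> \<ge> t\<close> and
      \<open>\<bar>x - M\<bar> \<ge> t - \<delta>\<close>, because the laws are compared through
      continuous functions. Letting \<open>\<delta>\<close> tend to 0 loses nothing, as the bound is
      continuous in \<open>t\<close>.\<close>
    define k where "k x = min 1 (max 0 ((\<bar>x - M\<bar> - (t - \<delta>)) / \<delta>))" for x
    have kc: "continuous_on UNIV k" unfolding k_def[abs_def] using \<delta> by (intro continuous_intros) auto
    have k01: "0 \<le> k x" "k x \<le> 1" for x by (auto simp: k_def)
    have [measurable]: "k \<in> borel_measurable borel" using kc by (rule borel_measurable_continuous_onI)
    have kA: "\<bar>k x\<bar> \<le> 1 * (1 + \<bar>x\<bar>)" for x using k01[of x] by simp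
    have "measure gauss {z. \<bar>f z - M\<bar> \<ge> t} = (\<integral>z. indicator {z. \<bar>f z - M\<bar> \<ge> t} z \<partial>gauss)"
      by simp
    also have "\<dots> \<le> (\<integral>z. k (f z) \<partial>gauss)"
    proof (rule integral_mono)
      show "integrable gauss (\<lambda>z. k (f z))" by (rule integrable_gauss_lipschitz_comp[OF f kc kA])
      show "integrable gauss (indicator {z. \<bar>f z - M\<bar> \<ge> t} :: 'a \<Rightarrow> real)"
        by (intro integrable_real_indicator) (auto simp: G.emeasure_eq_measure)
      show "indicator {z. \<bar>f z - M\<bar> \<ge> t} z \<le> k (f z)" for z
        using k01 \<delta> by (auto simp: indicator_def k_def field_simps)
    qed
    also have "\<dots> = (\<integral>s. k (T s) \<partial>std_normal_distribution)"
      by (rule Tk[OF kc kA, symmetric])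
    also have "\<dots> \<le> (\<integral>s. indicator {s. \<bar>T s - M\<bar> \<ge> t - \<delta>} s \<partial>std_normal_distribution)"
    proof (rule integral_mono)
      show "integrable std_normal_distribution (\<lambda>s. k (T s))"
        using integrable_gauss_lipschitz_comp[OF T(2) kc kA] by (simp add: gauss_real)
      show "integrable std_normal_distribution (indicator {s. \<bar>T s - M\<bar> \<ge> t - \<delta>} :: real \<Rightarrow> real)"
        by (intro integrable_real_indicator) (auto simp: N.emeasure_eq_measure)
      show "k (T s) \<le> indicator {s. \<bar>T s - M\<bar> \<ge> t - \<delta>} s" for s
        using k01[of "T s"] \<delta> by (auto simp: indicator_def k_def divide_nonpos_pos)
    qed
    also have "\<dots> = measure std_normal_distribution {s. \<bar>T s - M\<bar> \<ge> t - \<delta>}" by simp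
    also have "\<dots> \<le> exp (- (t - \<delta>)\<^sup>2 / 2)"
    proof (rule real_lipschitz_deviation)
      show "mono (\<lambda>s. T s - M)" using T(1) by (auto simp: mono_def)
      show "1-lipschitz_on UNIV (\<lambda>s. T s - M)"
        using T(2) by (auto simp: lipschitz_on_def dist_real_def)
    qed (use Ti TM \<delta> N.prob_space in auto)
    finally show ?thesis .
  qed
  show ?thesis
  proof (rule tendsto_lowerbound)
    show "((\<lambda>\<delta>. exp (- (t - \<delta>)\<^sup>2 / 2)) \<longlongrightarrow> exp (- t\<^sup>2 / 2)) (at_right 0)"
    proof -
      have "isCont (\<lambda>\<delta>. exp (- (t - \<delta>)\<^sup>2 / 2)) 0" by (intro continuous_intros) auto
      then show ?thesis by (auto simp: isCont_def filterlim_at_split)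
    qed
    show "\<forall>\<^sub>F \<delta> in at_right 0. measure gauss {z. \<bar>f z - M\<bar> \<ge> t} \<le> exp (- (t - \<delta>)\<^sup>2 / 2)"
      using bound t by (auto simp: eventually_at_right_field)
  qed simp
qed

lemma std_gaussian_eq_gauss: "std_gaussian = gauss"
  by (simp add: std_gaussian_def gauss_def)

theorem corollary4:
  fixes f :: "real ^ 'n \<Rightarrow> real" and L t M :: real
  assumes "L > 0"
    and "L-lipschitz_on UNIV f"
    and "M = (\<integral>x. f x \<partial>std_gaussian)"
    and "t > 0"
  shows "measure std_gaussian {x. \<bar>f x - M\<bar> \<ge> t} \<le> exp (- t\<^sup>2 / (2 * L\<^sup>2))"
proof -
  have "1-lipschitz_on UNIV (\<lambda>x. f x / L)"
  proof (rule lipschitz_onI)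
    show "dist (f x / L) (f y / L) \<le> 1 * dist x y" for x y
      using lipschitz_onD[OF assms(2), of x y] assms(1)
      by (simp add: dist_real_def pos_divide_le_eq mult.commute flip: diff_divide_distrib)
  qed simp
  moreover have "M / L = (\<integral>x. f x / L \<partial>gauss)"
    using assms(3) by (simp add: std_gaussian_eq_gauss)
  ultimately have "measure gauss {x. \<bar>f x / L - M / L\<bar> \<ge> t / L} \<le> exp (- (t / L)\<^sup>2 / 2)"
    using assms by (intro gauss_lipschitz_deviation) auto
  moreover have "\<bar>f x / L - M / L\<bar> \<ge> t / L \<longleftrightarrow> \<bar>f x - M\<bar> \<ge> t" for x
    using assms(1) by (simp add: divide_le_cancel flip: diff_divide_distrib)
  ultimately show ?thesis
    by (simp add: std_gaussian_eq_gauss power_divide mult.commute)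
qed

end
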